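(* There is an absolute constant $\kappa>0$ such that the following holds. Let $v_1,\dots,v_m\in\mathbb{R}^n$, $x\in[0,1]^m$, $c\in\mathbb{R}^m_+$ and $C=\langle c,x\rangle$. Suppose $\sum_{i=1}^mx_iv_iv_i^T=I_n$ and $C\ge15nc_\infty/\epsilon^2$. For any $\epsilon\in(0,\tfrac12]$, there is a randomized polynomial time algorithm that returns $z\in\{0,1\}^m$ such that $\langle c,z\rangle\le C$ and $\sum_{i=1}^mz_iv_iv_i^T\succeq(1-4\epsilon)I_n$ with probability at least $1-\exp(-\kappa n)$.
   Context: $c_\infty=\max_ic_i$; $\succeq$ is the positive semidefinite order. *)

theory Defs
  imports
    "HOL-Probability.Probability_Mass_Function"
    "HOL-Computational_Algebra.Polynomial"
    "Jordan_Normal_Form.Matrix"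
begin

unbundle no vec_syntax
unbundle no inner_syntax

text \<open>
  Vectors and matrices are those of Jordan_Normal_Form, whose dimensions are terms: one program has
  to serve all \<open>n\<close> and \<open>m\<close>, so the dimensions are quantified inside the statement.
\<close>

definition weighted_gram :: "nat \<Rightarrow> nat \<Rightarrow> real vec \<Rightarrow> (nat \<Rightarrow> real vec) \<Rightarrow> real mat" where
  "weighted_gram n m y v = mat n n (\<lambda>(a, b). \<Sum>i<m. y $ i * (v i $ a * v i $ b))"

definition psd :: "real mat \<Rightarrow> bool" where
  "psd A \<longleftrightarrow> square_mat A \<and> A\<^sup>T = A \<and>
     (\<forall>w \<in> carrier_vec (dim_row A). 0 \<le> w \<bullet> (A *\<^sub>v w))"

definition loewner_ge :: "real mat \<Rightarrow> real mat \<Rightarrow> bool"  (infix \<open>\<succeq>\<close> 50) where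
  "A \<succeq> B \<longleftrightarrow> psd (A - B)"

definition max_entry :: "real vec \<Rightarrow> real" where
  "max_entry c = Max {c $ i | i. i < dim_vec c}"


text \<open>
  Randomized algorithms are programs for a unit-cost real random access machine: exact
  \<open>+\<close>, \<open>-\<close>, \<open>*\<close>, \<open>/\<close> and comparison of reals, and index registers holding natural numbers that
  address two-dimensional arrays of reals. Three restrictions keep unit cost from hiding
  computational power: the only constants in a program are integers; indices have addition and
  subtraction but no multiplication; and nothing converts a real into an index (there is no floor
  function).
\<close>

type_synonym vname = string

datatype iexp = IConst nat | IVar vname | IAdd iexp iexp | ISub iexp iexp

datatype rexp =
    RConst int
  | RCell vname iexp iexp
  | RAdd rexp rexp | RSub rexp rexp | RMul rexp rexp | RDiv rexp rexp

datatype test = ILess iexp iexp | RLess rexp rexp | TNot test | TAnd test test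

text \<open>
  \<open>Flip i p\<close> draws \<open>u\<close> uniformly from the unit interval and sets index register \<open>i\<close> to \<open>1\<close> if
  \<open>u < p\<close> and to \<open>0\<close> otherwise; only the outcome of this comparison is available to the program.
\<close>

datatype com =
    Skip
  | IAssign vname iexp
  | RAssign vname iexp iexp rexp
  | Flip vname rexp
  | Seq com com
  | Cond test com com
  | While test com

record state =
  ireg :: "vname \<Rightarrow> nat"
  cell :: "vname \<Rightarrow> nat \<Rightarrow> nat \<Rightarrow> real"

primrec ival :: "iexp \<Rightarrow> state \<Rightarrow> nat" where
  "ival (IConst k) s = k"
| "ival (IVar i) s = ireg s i"
| "ival (IAdd a b) s = ival a s + ival b s"
| "ival (ISub a b) s = ival a s - ival b s"

primrec rval :: "rexp \<Rightarrow> state \<Rightarrow> real" where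
  "rval (RConst k) s = of_int k"
| "rval (RCell A a b) s = cell s A (ival a s) (ival b s)"
| "rval (RAdd p q) s = rval p s + rval q s"
| "rval (RSub p q) s = rval p s - rval q s"
| "rval (RMul p q) s = rval p s * rval q s"
| "rval (RDiv p q) s = rval p s / rval q s"

primrec tval :: "test \<Rightarrow> state \<Rightarrow> bool" where
  "tval (ILess a b) s \<longleftrightarrow> ival a s < ival b s"
| "tval (RLess p q) s \<longleftrightarrow> rval p s < rval q s"
| "tval (TNot t) s \<longleftrightarrow> \<not> tval t s"
| "tval (TAnd t u) s \<longleftrightarrow> tval t s \<and> tval u s"

definition set_ireg :: "vname \<Rightarrow> nat \<Rightarrow> state \<Rightarrow> state" where
  "set_ireg i k s = s\<lparr>ireg := (ireg s)(i := k)\<rparr>"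

definition set_cell :: "vname \<Rightarrow> nat \<Rightarrow> nat \<Rightarrow> real \<Rightarrow> state \<Rightarrow> state" where
  "set_cell A a b r s = s\<lparr>cell := (cell s)(A := (cell s A)(a := (cell s A a)(b := r)))\<rparr>"

text \<open>
  One step evaluates a bounded number of expressions of the fixed program text, so the number of
  steps is the number of machine operations up to a factor depending on the program only.
  A configuration has halted iff its command is \<open>Skip\<close>; halted configurations stay put.
\<close>

primrec step :: "com \<Rightarrow> state \<Rightarrow> (com \<times> state) pmf" where
  "step Skip s = return_pmf (Skip, s)"
| "step (IAssign i a) s = return_pmf (Skip, set_ireg i (ival a s) s)"
| "step (RAssign A a b r) s = return_pmf (Skip, set_cell A (ival a s) (ival b s) (rval r s) s)"
| "step (Flip i p) s =
     map_pmf (\<lambda>h. (Skip, set_ireg i (if h then 1 else 0) s)) (bernoulli_pmf (rval p s))"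
| "step (Seq c1 c2) s =
     (if c1 = Skip then return_pmf (c2, s)
      else map_pmf (\<lambda>(c1', s'). (Seq c1' c2, s')) (step c1 s))"
| "step (Cond t c1 c2) s = return_pmf (if tval t s then c1 else c2, s)"
| "step (While t c) s = return_pmf (if tval t s then Seq c (While t c) else Skip, s)"

primrec run :: "nat \<Rightarrow> com \<times> state \<Rightarrow> (com \<times> state) pmf" where
  "run 0 cfg = return_pmf cfg"
| "run (Suc k) cfg = bind_pmf (step (fst cfg) (snd cfg)) (run k)"

definition halts_within :: "nat \<Rightarrow> com \<Rightarrow> state \<Rightarrow> bool" where
  "halts_within T prog s \<longleftrightarrow> (\<forall>cfg \<in> set_pmf (run T (prog, s)). fst cfg = Skip)"


definition input_state ::
    "nat \<Rightarrow> nat \<Rightarrow> (nat \<Rightarrow> real vec) \<Rightarrow> real vec \<Rightarrow> real vec \<Rightarrow> real \<Rightarrow> state" where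
  "input_state n m v x c \<epsilon> =
     \<lparr>ireg = (\<lambda>_. 0)(''n'' := n, ''m'' := m),
      cell = (\<lambda>A i j.
        if A = ''v'' \<and> i < m \<and> j < n then v i $ j
        else if A = ''x'' \<and> i < m \<and> j = 0 then x $ i
        else if A = ''c'' \<and> i < m \<and> j = 0 then c $ i
        else if A = ''eps'' \<and> i = 0 \<and> j = 0 then \<epsilon>
        else 0)\<rparr>"

definition output_vec :: "nat \<Rightarrow> state \<Rightarrow> real vec" where
  "output_vec m s = vec m (\<lambda>i. cell s ''z'' i 0)"

end

theory Submission
  imports Defs
begin

text \<open>
  The program is deterministic, so its success probability is \<open>1\<close>. It is a local search over subsets
  \<open>S\<close>, started at the full set, for the potential
  \<open>tr B + (\<Sum>i\<in>S. c\<^sub>i / c\<^sub>\<infinity>)\<close>, where \<open>B\<close> is the inverse of \<open>(\<Sum>i\<in>S. v\<^sub>i v\<^sub>i\<^sup>T) - (1 - 4\<epsilon>) I\<close>,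
  in which a single index is added or removed as long as the matrix stays positive definite and the
  potential drops by more than \<open>1 / m\<close>. Positive definiteness is the spectral guarantee. As the
  potential starts below \<open>2 m + 1\<close> and stays nonnegative, \<open>(2 m + 1) m\<close> sweeps reach a local optimum.

  At a local optimum the cost is at most \<open>\<langle>c, x\<rangle>\<close>: with \<open>b\<^sub>i = v\<^sub>i\<^sup>T B v\<^sub>i\<close> and \<open>g = 1 - 2\<epsilon>\<close>, average the
  optimality conditions with weight \<open>(1 - g x\<^sub>i) (1 - b\<^sub>i)\<^sub>+\<close> for removing and \<open>g x\<^sub>i (1 + b\<^sub>i)\<close> for adding
  \<open>i\<close>. Against these weights the Sherman--Morrison denominators cancel, the spectral part is at most
  \<open>tr B - 2\<epsilon> tr B\<^sup>2\<close>, and what the factors \<open>1 \<plusminus> b\<^sub>i\<close> add to the cost is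
  \<open>O(c\<^sub>\<infinity> (n + tr B))\<close>. The total is \<open>O(c\<^sub>\<infinity> n / \<epsilon>)\<close>, which the slack
  \<open>2\<epsilon> \<langle>c, x\<rangle> \<ge> 30 n c\<^sub>\<infinity> / \<epsilon>\<close> absorbs.
\<close>

notation Seq (infixr \<open>;;\<close> 60)

section \<open>Total correctness with a step bound\<close>

text \<open>A point mass is demanded because the program never flips a coin. Halted configurations
  stay put, so \<open>K\<close> is an upper bound on the number of steps, not an exact
  count.\<close>

definition wp :: "com \<Rightarrow> nat \<Rightarrow> (state \<Rightarrow> bool) \<Rightarrow> state \<Rightarrow> bool" where
  "wp c K Q s \<longleftrightarrow> (\<exists>s'. run K (c, s) = return_pmf (Skip, s') \<and> Q s')"

lemma run_Skip: "run K (Skip, s) = return_pmf (Skip, s)"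
  by (induction K) (auto simp: bind_return_pmf)

text \<open>The support of \<open>f y\<close> lies inside the singleton support of the whole. This
  lets inductions on \<open>run\<close> pass to every successor without first showing that
  \<open>step\<close> is deterministic.\<close>

lemma bind_pmf_eq_return_pmf:
  assumes "bind_pmf p f = return_pmf r" "y \<in> set_pmf p"
  shows "f y = return_pmf r"
proof -
  have "set_pmf (f y) \<subseteq> set_pmf (bind_pmf p f)" using assms(2) by auto
  then show ?thesis by (simp add: assms(1) set_pmf_subset_singleton)
qed

lemma run_mono:
  assumes "run K cfg = return_pmf (Skip, s')" "K \<le> K'"
  shows "run K' cfg = return_pmf (Skip, s')"
  using assms
proof (induction K arbitrary: K' cfg)
  case 0
  then show ?case by (auto simp: run_Skip)
next
  case (Suc K)
  then obtain L where L: "K' = Suc L" "K \<le> L" by (cases K') auto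
  have "run L y = return_pmf (Skip, s')" if "y \<in> set_pmf (step (fst cfg) (snd cfg))" for y
    using Suc.IH[OF bind_pmf_eq_return_pmf[OF _ that] L(2)] Suc.prems(1) by simp
  then have "bind_pmf (step (fst cfg) (snd cfg)) (run L) =
      bind_pmf (step (fst cfg) (snd cfg)) (\<lambda>_. return_pmf (Skip, s'))"
    by (intro bind_pmf_cong) auto
  then show ?case by (simp add: L)
qed

text \<open>The additional step discards the finished \<open>Skip\<close> in front of
  \<open>d\<close>. If \<open>c\<close> halts early, the fuel left over is absorbed by
  \<open>run_mono\<close>.\<close>

lemma run_Seq:
  assumes "run K (c, s) = return_pmf (Skip, s')" "run L (d, s') = return_pmf (Skip, s'')"
  shows "run (K + L + 1) (c ;; d, s) = return_pmf (Skip, s'')"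
  using assms(1)
proof (induction K arbitrary: c s)
  case 0
  then show ?case using assms(2) by (simp add: bind_return_pmf)
next
  case (Suc K)
  show ?case
  proof (cases "c = Skip")
    case True
    with Suc.prems have "s' = s" using run_Skip[of "Suc K" s] by auto
    then show ?thesis using True run_mono[OF assms(2), of "Suc K + L"]
      by (simp add: bind_return_pmf)
  next
    case False
    have "run (K + L + 1) (c' ;; d, t) = return_pmf (Skip, s'')"
      if "(c', t) \<in> set_pmf (step c s)" for c' t
      by (rule Suc.IH, rule bind_pmf_eq_return_pmf[OF _ that]) (use Suc.prems in simp)
    then have "bind_pmf (step c s) (\<lambda>y. run (K + L + 1) (case y of (c', t) \<Rightarrow> (c' ;; d, t))) =
        bind_pmf (step c s) (\<lambda>_. return_pmf (Skip, s''))"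
      by (intro bind_pmf_cong) auto
    moreover have "run (Suc K + L + 1) (c ;; d, s) =
        bind_pmf (step c s) (\<lambda>y. run (K + L + 1) (case y of (c', t) \<Rightarrow> (c' ;; d, t)))"
      using False by (simp add: bind_map_pmf)
    ultimately show ?thesis by simp
  qed
qed

lemma wp_conseq: "wp c K Q s \<Longrightarrow> (\<And>t. Q t \<Longrightarrow> R t) \<Longrightarrow> K \<le> L \<Longrightarrow> wp c L R s"
  unfolding wp_def using run_mono by blast

lemma wp_time: "wp c K Q s \<Longrightarrow> K \<le> L \<Longrightarrow> wp c L Q s"
  by (rule wp_conseq)

lemma wp_Skip: "Q s \<Longrightarrow> wp Skip K Q s"
  by (simp add: wp_def run_Skip)

lemma wp_IAssign: "Q (set_ireg i (ival a s) s) \<Longrightarrow> wp (IAssign i a) 1 Q s"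
  by (simp add: wp_def bind_return_pmf)

lemma wp_RAssign:
  "Q (set_cell A (ival a s) (ival b s) (rval r s) s) \<Longrightarrow> wp (RAssign A a b r) 1 Q s"
  by (simp add: wp_def bind_return_pmf)

lemma wp_Seq: "wp c K (wp d L Q) s \<Longrightarrow> wp (c ;; d) (K + L + 1) Q s"
  unfolding wp_def using run_Seq by blast

lemma wp_Cond:
  assumes "tval t s \<Longrightarrow> wp c K Q s" "\<not> tval t s \<Longrightarrow> wp d K Q s"
  shows "wp (Cond t c d) (K + 1) Q s"
  using assms by (cases "tval t s") (auto simp: wp_def bind_return_pmf)

lemma wp_While_True:
  "tval t s \<Longrightarrow> wp (c ;; While t c) K Q s \<Longrightarrow> wp (While t c) (K + 1) Q s"
  by (auto simp: wp_def bind_return_pmf)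

lemma wp_While_False: "\<not> tval t s \<Longrightarrow> Q s \<Longrightarrow> wp (While t c) 1 Q s"
  by (auto simp: wp_def bind_return_pmf)

definition For :: "vname \<Rightarrow> iexp \<Rightarrow> com \<Rightarrow> com" where
  "For i e c = IAssign i (IConst 0) ;;
     While (ILess (IVar i) e) (c ;; IAssign i (IAdd (IVar i) (IConst 1)))"

text \<open>Each iteration pays \<open>4\<close> beyond the body: the loop test, the increment and
  two sequencing steps. The final \<open>3\<close> are the initialisation, its sequencing step and
  the failing test. Any \<open>L \<ge> N\<close> is allowed, so that nested loops get bounds in one
  common size parameter.\<close>

lemma wp_For:
  assumes init: "P 0 (set_ireg i 0 s)"
    and bound: "\<And>j t. P j t \<Longrightarrow> ireg t i = j \<and> ival e t = N"
    and body: "\<And>j t. j < N \<Longrightarrow> P j t \<Longrightarrow>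
      wp c K (\<lambda>t'. P (Suc j) (set_ireg i (Suc (ireg t' i)) t')) t"
    and post: "\<And>t. P N t \<Longrightarrow> Q t"
    and "N \<le> L"
  shows "wp (For i e c) (L * (K + 4) + 3) Q s"
proof -
  let ?W = "While (ILess (IVar i) e) (c ;; IAssign i (IAdd (IVar i) (IConst 1)))"
  have loop: "wp ?W ((N - j) * (K + 4) + 1) Q t" if "P j t" "j \<le> N" for j t
    using that
  proof (induction "N - j" arbitrary: j t)
    case 0
    then have "j = N" by simp
    have "wp ?W 1 Q t"
      by (rule wp_While_False) (use 0 \<open>j = N\<close> bound[of N t] post in auto)
    then show ?case using 0 by simp
  next
    case (Suc k)
    have "wp ?W (((K + 1 + 1) + ((N - Suc j) * (K + 4) + 1) + 1) + 1) Q t"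
    proof (intro wp_While_True wp_Seq)
      show "tval (ILess (IVar i) e) t" using Suc bound by fastforce
      show "wp c K (wp (IAssign i (IAdd (IVar i) (IConst 1))) 1
          (wp ?W ((N - Suc j) * (K + 4) + 1) Q)) t"
      proof (rule wp_conseq[OF body[OF _ Suc.prems(1)]])
        fix t assume "P (Suc j) (set_ireg i (Suc (ireg t i)) t)"
        then have "wp ?W ((N - Suc j) * (K + 4) + 1) Q (set_ireg i (Suc (ireg t i)) t)"
          by (intro Suc.hyps(1)) (use Suc.hyps(2) in auto)
        then show "wp (IAssign i (IAdd (IVar i) (IConst 1))) 1
            (wp ?W ((N - Suc j) * (K + 4) + 1) Q) t"
          by (intro wp_IAssign) simp
      qed (use Suc.hyps(2) in auto)
    qed
    then show ?case
    proof (rule wp_conseq)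
      have "N - j = Suc (N - Suc j)" using Suc.hyps(2) by simp
      then show "K + 1 + 1 + ((N - Suc j) * (K + 4) + 1) + 1 + 1 \<le> (N - j) * (K + 4) + 1" by simp
    qed
  qed
  have "wp (For i e c) (1 + (N * (K + 4) + 1) + 1) Q s"
    unfolding For_def using loop[OF init] by (intro wp_Seq wp_IAssign) simp
  then show ?thesis
    by (rule wp_time) (use mult_le_mono1[OF \<open>N \<le> L\<close>, of "K + 4"] in simp)
qed

section \<open>Rank-one updates and local optima\<close>

text \<open>Vectors and matrices are plain functions, the form in which a machine state stores them;
  indices from \<open>n\<close> on are ignored.\<close>

definition mv :: "nat \<Rightarrow> (nat \<Rightarrow> nat \<Rightarrow> real) \<Rightarrow> (nat \<Rightarrow> real) \<Rightarrow> nat \<Rightarrow> real" where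
  "mv n A w j = (\<Sum>k<n. A j k * w k)"

definition dot :: "nat \<Rightarrow> (nat \<Rightarrow> real) \<Rightarrow> (nat \<Rightarrow> real) \<Rightarrow> real" where
  "dot n w y = (\<Sum>j<n. w j * y j)"

definition delta :: "nat \<Rightarrow> nat \<Rightarrow> real" where
  "delta j k = (if j = k then 1 else 0)"

lemma sum_mult_delta: "k < n \<Longrightarrow> (\<Sum>l<n. f l * delta k l) = f k"
  by (simp add: delta_def if_distrib[of "\<lambda>u. _ * u"] cong: if_cong)

lemma sum_delta_mult: "k < n \<Longrightarrow> (\<Sum>l<n. delta k l * f l) = f k"
  by (simp add: sum_mult_delta mult.commute[of "delta _ _"])

lemma mv_delta: "j < n \<Longrightarrow> mv n (\<lambda>j k. r * delta j k) w j = r * w j"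
  by (simp add: mv_def delta_def if_distrib[of "\<lambda>u. u * _"] if_distrib[of "\<lambda>u. r * u"] cong: if_cong)

lemma dot_commute: "dot n w y = dot n y w"
  by (simp add: dot_def mult.commute)

lemma dot_self_nonneg: "0 \<le> dot n w w"
  unfolding dot_def by (intro sum_nonneg) simp

lemma dot_cong: "(\<And>j. j < n \<Longrightarrow> w j = w' j) \<Longrightarrow> (\<And>j. j < n \<Longrightarrow> y j = y' j) \<Longrightarrow> dot n w y = dot n w' y'"
  by (simp add: dot_def)

lemma dot_add_right: "dot n w (\<lambda>j. y j + r * z j) = dot n w y + r * dot n w z"
  by (simp add: dot_def algebra_simps sum.distrib sum_distrib_left)

lemma dot_add_left: "dot n (\<lambda>j. y j + r * z j) w = dot n y w + r * dot n z w"
  by (simp add: dot_def algebra_simps sum.distrib sum_distrib_left)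

lemma mv_add: "mv n A (\<lambda>j. y j + r * z j) k = mv n A y k + r * mv n A z k"
  by (simp add: mv_def algebra_simps sum.distrib sum_distrib_left)

lemma dot_mv_commute:
  assumes "\<And>j k. j < n \<Longrightarrow> k < n \<Longrightarrow> A j k = A k j"
  shows "dot n w (mv n A y) = dot n y (mv n A w)"
proof -
  have "dot n w (mv n A y) = (\<Sum>j<n. \<Sum>k<n. w j * (A j k * y k))"
    by (simp add: dot_def mv_def sum_distrib_left)
  also have "\<dots> = (\<Sum>k<n. \<Sum>j<n. w j * (A j k * y k))" by (rule sum.swap)
  also have "\<dots> = (\<Sum>k<n. \<Sum>j<n. y k * (A k j * w j))"
    by (intro sum.cong) (auto simp: assms)
  also have "\<dots> = dot n y (mv n A w)" by (simp add: dot_def mv_def sum_distrib_left)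
  finally show ?thesis .
qed

text \<open>Semidefiniteness of \<open>A\<close> together with the left inverse \<open>B\<close>
  amounts to positive definiteness. \<open>B\<close> is an explicit argument because it is the
  matrix that the program stores.\<close>

definition psd_inverse :: "nat \<Rightarrow> (nat \<Rightarrow> nat \<Rightarrow> real) \<Rightarrow> (nat \<Rightarrow> nat \<Rightarrow> real) \<Rightarrow> bool" where
  "psd_inverse n A B \<longleftrightarrow>
     (\<forall>j<n. \<forall>k<n. A j k = A k j \<and> B j k = B k j \<and> (\<Sum>l<n. B j l * A l k) = delta j k) \<and>
     (\<forall>w. 0 \<le> dot n w (mv n A w))"

lemma psd_inverse_cong:
  assumes "psd_inverse n A B"
    and eq: "\<And>j k. j < n \<Longrightarrow> k < n \<Longrightarrow> A j k = A' j k" "\<And>j k. j < n \<Longrightarrow> k < n \<Longrightarrow> B j k = B' j k"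
  shows "psd_inverse n A' B'"
proof -
  have "dot n w (mv n A' w) = dot n w (mv n A w)" for w
    by (simp add: dot_def mv_def eq)
  moreover have "(\<Sum>l<n. B' j l * A' l k) = (\<Sum>l<n. B j l * A l k)" if "j < n" "k < n" for j k
    using that by (simp add: eq)
  ultimately show ?thesis using assms(1) eq unfolding psd_inverse_def by metis
qed

section \<open>Positive definite matrices and their inverses\<close>

context
  fixes n A B
  assumes inv: "psd_inverse n A B"
begin

lemma psd_inverse_sym: "j < n \<Longrightarrow> k < n \<Longrightarrow> A j k = A k j" "j < n \<Longrightarrow> k < n \<Longrightarrow> B j k = B k j"
  using inv unfolding psd_inverse_def by blast+

lemma psd_inverse_mult: "j < n \<Longrightarrow> k < n \<Longrightarrow> (\<Sum>l<n. B j l * A l k) = delta j k"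
  using inv unfolding psd_inverse_def by blast

text \<open>By symmetry of both matrices the left inverse is also a right inverse.\<close>

lemma psd_inverse_mv: "k < n \<Longrightarrow> mv n A (mv n B w) k = w k"
proof -
  assume k: "k < n"
  have "mv n A (mv n B w) k = (\<Sum>l<n. \<Sum>p<n. A k l * (B l p * w p))"
    by (simp add: mv_def sum_distrib_left)
  also have "\<dots> = (\<Sum>p<n. \<Sum>l<n. A k l * (B l p * w p))" by (rule sum.swap)
  also have "\<dots> = (\<Sum>p<n. delta p k * w p)"
    using k psd_inverse_sym
    by (intro sum.cong refl) (simp add: sum_distrib_left mult_ac flip: psd_inverse_mult)
  also have "\<dots> = w k" using k by (simp add: delta_def if_distrib[of "\<lambda>u. u * _"] cong: if_cong)
  finally show ?thesis .
qed

text \<open>Since \<open>w = A (B w)\<close>, the form of \<open>B\<close> at \<open>w\<close> is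
  the form of \<open>A\<close> at \<open>B w\<close>.\<close>

lemma psd_inverse_nonneg: "0 \<le> dot n w (mv n B w)"
proof -
  have "dot n w (mv n B w) = dot n (mv n B w) (mv n A (mv n B w))"
    by (subst dot_commute) (rule dot_cong, simp_all add: psd_inverse_mv)
  then show ?thesis using inv by (simp add: psd_inverse_def)
qed

lemma psd_inverse_diag_nonneg: "j < n \<Longrightarrow> 0 \<le> B j j"
  using psd_inverse_nonneg[of "delta j"]
  by (simp add: dot_def mv_def delta_def if_distrib[of "\<lambda>u. u * _"] if_distrib[of "\<lambda>u. _ * u"]
      cong: if_cong)

text \<open>The Sherman--Morrison formula. For negative \<open>s\<close> positivity of the updated matrix is obtained by
  evaluating the old quadratic form at \<open>w + s \<langle>w, y\<rangle> B y\<close>.\<close>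
lemma psd_inverse_rank_one:
  assumes pos: "0 < 1 + s * dot n y (mv n B y)"
  shows "psd_inverse n (\<lambda>j k. A j k + s * (y j * y k))
    (\<lambda>j k. B j k - s / (1 + s * dot n y (mv n B y)) * (mv n B y j * mv n B y k))"
proof -
  define u where "u = mv n B y"
  define b where "b = dot n y u"
  define r where "r = s / (1 + s * b)"
  \<comment> \<open>The product needs only this identity: the rank-one remainder has coefficient
    \<open>s - r * (1 + s * b)\<close>.\<close>
  have r: "s = r * (1 + s * b)" using pos by (simp add: r_def b_def u_def)
  have Au: "k < n \<Longrightarrow> mv n A u k = y k" for k using psd_inverse_mv by (simp add: u_def)
  have prod: "(\<Sum>l<n. (B j l - r * (u j * u l)) * (A l k + s * (y l * y k))) = delta j k"
    if jk: "j < n" "k < n" for j k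
  proof -
    have "(\<Sum>l<n. (B j l - r * (u j * u l)) * (A l k + s * (y l * y k))) =
        (\<Sum>l<n. B j l * A l k) + s * y k * (\<Sum>l<n. B j l * y l)
        - r * u j * (\<Sum>l<n. A l k * u l) - r * s * u j * y k * (\<Sum>l<n. y l * u l)"
      by (simp add: algebra_simps sum.distrib sum_subtractf sum_distrib_left)
    also have "(\<Sum>l<n. A l k * u l) = (\<Sum>l<n. A k l * u l)"
      using jk psd_inverse_sym(1) by (intro sum.cong) auto
    also have "\<dots> = y k" using Au[OF jk(2)] by (simp add: mv_def)
    also have "(\<Sum>l<n. B j l * y l) = u j" by (simp add: u_def mv_def)
    also have "(\<Sum>l<n. y l * u l) = b" by (simp add: b_def dot_def)
    also have "(\<Sum>l<n. B j l * A l k) + s * y k * u j - r * u j * y k - r * s * u j * y k * b =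
        delta j k + (s - r * (1 + s * b)) * (u j * y k)"
      using psd_inverse_mult[OF jk] by (simp add: algebra_simps)
    finally show ?thesis using r by simp
  qed
  have nonneg: "0 \<le> dot n w (mv n (\<lambda>j k. A j k + s * (y j * y k)) w)" for w
  proof -
    define t where "t = dot n w y"
    have eq: "dot n w (mv n (\<lambda>j k. A j k + s * (y j * y k)) w) = dot n w (mv n A w) + s * t\<^sup>2"
    proof -
      have "mv n (\<lambda>j k. A j k + s * (y j * y k)) w = (\<lambda>j. mv n A w j + (s * t) * y j)"
        by (simp add: fun_eq_iff mv_def t_def dot_def algebra_simps sum.distrib sum_distrib_left)
      then show ?thesis by (simp add: dot_add_right t_def power2_eq_square)
    qed
    have nn: "0 \<le> dot n w (mv n A w)" for w using inv by (simp add: psd_inverse_def)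
    have wAu: "dot n w (mv n A u) = t"
      unfolding t_def by (rule dot_cong) (simp_all add: Au)
    have uAu: "dot n u (mv n A u) = b"
      unfolding b_def by (subst dot_commute) (rule dot_cong, simp_all add: Au)
    have "0 \<le> dot n (\<lambda>j. w j + (s * t) * u j) (mv n A (\<lambda>j. w j + (s * t) * u j))" by (rule nn)
    also have "mv n A (\<lambda>j. w j + (s * t) * u j) = (\<lambda>k. mv n A w k + (s * t) * mv n A u k)"
      by (simp add: mv_add fun_eq_iff)
    also have "dot n (\<lambda>j. w j + (s * t) * u j) (\<lambda>k. mv n A w k + (s * t) * mv n A u k) =
        dot n w (mv n A w) + (s * t) * t + (s * t) * (t + (s * t) * b)"
      using dot_mv_commute[of n A u w] psd_inverse_sym(1) wAu uAu
      by (simp add: dot_add_left dot_add_right)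
    finally have ge: "- (2 * s * t\<^sup>2 + s\<^sup>2 * t\<^sup>2 * b) \<le> dot n w (mv n A w)"
      by (simp add: power2_eq_square algebra_simps)
    show ?thesis
    proof (cases "0 \<le> s")
      case True
      then show ?thesis using nn[of w] by (simp add: eq)
    next
      case False
      \<comment> \<open>Adding \<open>s * t\<^sup>2\<close> to the lower bound \<open>ge\<close>
        leaves exactly this product.\<close>
      have "0 \<le> (- s) * t\<^sup>2 * (1 + s * b)"
        using False pos by (intro mult_nonneg_nonneg) (auto simp: b_def u_def)
      then show ?thesis using ge by (simp add: eq power2_eq_square algebra_simps)
    qed
  qed
  have "psd_inverse n (\<lambda>j k. A j k + s * (y j * y k)) (\<lambda>j k. B j k - r * (u j * u k))"
    unfolding psd_inverse_def
  proof (intro conjI allI impI)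
    fix j k assume "j < n" "k < n"
    then show "A j k + s * (y j * y k) = A k j + s * (y k * y j)"
      "B j k - r * (u j * u k) = B k j - r * (u k * u j)"
      using psd_inverse_sym by (simp_all add: mult.commute)
  qed (fact prod nonneg)+
  then show ?thesis by (simp only: r_def b_def u_def)
qed

end

text \<open>With the fractional weights \<open>x\<close> the shifted matrix is
  \<open>4 * \<epsilon>\<close> times the identity, which gives the program its first
  inverse.\<close>

lemma psd_inverse_scalar:
  assumes "0 < r"
  shows "psd_inverse n (\<lambda>j k. r * delta j k) (\<lambda>j k. 1 / r * delta j k)"
proof -
  have "(\<Sum>l<n. 1 / r * delta j l * (r * delta l k)) = delta j k" if "j < n" "k < n" for j k
  proof -
    have "(\<Sum>l<n. 1 / r * delta j l * (r * delta l k)) = (\<Sum>l<n. delta j l * delta l k)"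
      using assms by (intro sum.cong) auto
    then show ?thesis using that by (simp add: sum_delta_mult)
  qed
  moreover have "0 \<le> dot n w (mv n (\<lambda>j k. r * delta j k) w)" for w
  proof -
    have "dot n w (mv n (\<lambda>j k. r * delta j k) w) = dot n w (\<lambda>j. r * w j)"
      by (rule dot_cong) (simp_all add: mv_delta)
    also have "\<dots> = r * dot n w w" by (simp add: dot_def sum_distrib_left mult_ac)
    finally show ?thesis using assms by (simp add: dot_self_nonneg)
  qed
  ultimately show ?thesis unfolding psd_inverse_def by (simp add: delta_def)
qed

section \<open>Traces and weighted sums of quadratic forms\<close>

definition tr :: "nat \<Rightarrow> (nat \<Rightarrow> nat \<Rightarrow> real) \<Rightarrow> real" where
  "tr n B = (\<Sum>j<n. B j j)"

lemma tr_nonneg: "psd_inverse n A B \<Longrightarrow> 0 \<le> tr n B"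
  unfolding tr_def by (intro sum_nonneg) (auto intro: psd_inverse_diag_nonneg)

lemma tr_rank_one: "tr n (\<lambda>j k. B j k - r * (u j * u k)) = tr n B - r * dot n u u"
  by (simp add: tr_def dot_def sum_subtractf sum_distrib_left)

lemma sum_dot_sq_gram:
  fixes y w :: "nat \<Rightarrow> real" and V G :: "nat \<Rightarrow> nat \<Rightarrow> real"
  assumes "\<And>k l. k < n \<Longrightarrow> l < n \<Longrightarrow> (\<Sum>i<m. y i * (V i k * V i l)) = G k l"
  shows "(\<Sum>i<m. y i * (\<Sum>j<n. w j * V i j)\<^sup>2) = (\<Sum>k<n. \<Sum>l<n. w k * w l * G k l)"
proof -
  have "(\<Sum>j<n. w j * V i j)\<^sup>2 = (\<Sum>k<n. \<Sum>l<n. w k * w l * (V i k * V i l))" for i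
    by (simp add: power2_eq_square sum_product mult_ac)
  then have "(\<Sum>i<m. y i * (\<Sum>j<n. w j * V i j)\<^sup>2) =
      (\<Sum>i<m. \<Sum>k<n. \<Sum>l<n. w k * w l * (y i * (V i k * V i l)))"
    by (simp add: sum_distrib_left mult_ac)
  also have "\<dots> = (\<Sum>k<n. \<Sum>i<m. \<Sum>l<n. w k * w l * (y i * (V i k * V i l)))" by (rule sum.swap)
  also have "\<dots> = (\<Sum>k<n. \<Sum>l<n. \<Sum>i<m. w k * w l * (y i * (V i k * V i l)))"
    by (rule sum.cong[OF refl]) (rule sum.swap)
  also have "\<dots> = (\<Sum>k<n. \<Sum>l<n. w k * w l * G k l)"
    by (simp add: assms flip: sum_distrib_left)
  finally show ?thesis .
qed

text \<open>The right-hand side is the trace of \<open>B\<^sup>T G\<close>: the sum depends on the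
  vectors only through their weighted Gram matrix \<open>G\<close>.\<close>

lemma sum_dot_mv_gram:
  fixes y :: "nat \<Rightarrow> real"
  assumes "\<And>k l. k < n \<Longrightarrow> l < n \<Longrightarrow> (\<Sum>i<m. y i * (V i k * V i l)) = G k l"
  shows "(\<Sum>i<m. y i * dot n (V i) (mv n B (V i))) = (\<Sum>k<n. \<Sum>l<n. B k l * G k l)"
proof -
  have "(\<Sum>i<m. y i * dot n (V i) (mv n B (V i))) =
      (\<Sum>i<m. \<Sum>k<n. \<Sum>l<n. B k l * (y i * (V i k * V i l)))"
    by (simp add: dot_def mv_def sum_distrib_left mult_ac)
  also have "\<dots> = (\<Sum>k<n. \<Sum>i<m. \<Sum>l<n. B k l * (y i * (V i k * V i l)))" by (rule sum.swap)
  also have "\<dots> = (\<Sum>k<n. \<Sum>l<n. \<Sum>i<m. B k l * (y i * (V i k * V i l)))"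
    by (rule sum.cong[OF refl]) (rule sum.swap)
  also have "\<dots> = (\<Sum>k<n. \<Sum>l<n. B k l * G k l)"
    by (simp add: assms flip: sum_distrib_left)
  finally show ?thesis .
qed

text \<open>The right-hand side is the trace of \<open>B G B\<^sup>T\<close>; each row of
  \<open>B\<close> contributes one quadratic form of \<open>G\<close>.\<close>

lemma sum_dot_mv_mv_gram:
  fixes y :: "nat \<Rightarrow> real"
  assumes "\<And>k l. k < n \<Longrightarrow> l < n \<Longrightarrow> (\<Sum>i<m. y i * (V i k * V i l)) = G k l"
  shows "(\<Sum>i<m. y i * dot n (mv n B (V i)) (mv n B (V i))) =
    (\<Sum>j<n. \<Sum>k<n. \<Sum>l<n. B j k * B j l * G k l)"
proof -
  have "(\<Sum>i<m. y i * dot n (mv n B (V i)) (mv n B (V i))) =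
      (\<Sum>i<m. \<Sum>j<n. y i * (\<Sum>k<n. B j k * V i k)\<^sup>2)"
    by (simp add: dot_def mv_def sum_distrib_left power2_eq_square)
  also have "\<dots> = (\<Sum>j<n. \<Sum>i<m. y i * (\<Sum>k<n. B j k * V i k)\<^sup>2)" by (rule sum.swap)
  also have "\<dots> = (\<Sum>j<n. \<Sum>k<n. \<Sum>l<n. B j k * B j l * G k l)"
    by (rule sum.cong[OF refl], rule sum_dot_sq_gram) (rule assms)
  finally show ?thesis .
qed

text \<open>By Sherman--Morrison this is the drop of the potential when \<open>s\<close> times the
  rank-one matrix of \<open>y\<close> is added: the quotient is the decrease of the trace of the
  inverse, \<open>s * w\<close> the increase of the cost.\<close>

definition toggle_gain :: "nat \<Rightarrow> (nat \<Rightarrow> nat \<Rightarrow> real) \<Rightarrow> (nat \<Rightarrow> real) \<Rightarrow> real \<Rightarrow> real \<Rightarrow> real" where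
  "toggle_gain n B y w s = s * dot n (mv n B y) (mv n B y) / (1 + s * dot n y (mv n B y)) - s * w"

text \<open>For \<open>z\<close> in \<open>{0, 1}\<close> the sign \<open>1 - 2 * z\<close> is
  \<open>1\<close> for adding and \<open>-1\<close> for removing. The first conjunct keeps the
  updated matrix positive definite and the denominator of the gain positive.\<close>

definition improvable :: "nat \<Rightarrow> real \<Rightarrow> (nat \<Rightarrow> nat \<Rightarrow> real) \<Rightarrow> (nat \<Rightarrow> real) \<Rightarrow> real \<Rightarrow> real \<Rightarrow> bool" where
  "improvable n \<eta> B y w z \<longleftrightarrow>
     0 < 1 + (1 - 2 * z) * dot n y (mv n B y) \<and> \<eta> < toggle_gain n B y w (1 - 2 * z)"

definition shifted_gram :: "nat \<Rightarrow> real \<Rightarrow> (nat \<Rightarrow> nat \<Rightarrow> real) \<Rightarrow> (nat \<Rightarrow> real) \<Rightarrow> nat \<Rightarrow> nat \<Rightarrow> real" where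
  "shifted_gram m r V y j k = (\<Sum>i<m. y i * (V i j * V i k)) - r * delta j k"

lemma shifted_gram_upd:
  assumes "i < m"
  shows "shifted_gram m r V (y(i := y i + s)) j k = shifted_gram m r V y j k + s * (V i j * V i k)"
proof -
  have "(\<Sum>l<m. (y(i := y i + s)) l * (V l j * V l k)) =
      (\<Sum>l<m. y l * (V l j * V l k) + (if l = i then s * (V i j * V i k) else 0))"
    by (intro sum.cong) (auto simp: algebra_simps)
  then show ?thesis using assms by (simp add: shifted_gram_def sum.distrib)
qed

text \<open>Multiplying the failed gain inequality by its denominator gives one linear condition for
  both directions. A removal with \<open>\<langle>y, B y\<rangle> \<ge> 1\<close> is blocked by
  definiteness, but then the last summand already dominates \<open>w\<close>.\<close>

lemma not_improvable_toggle:
  assumes "\<not> improvable n \<eta> B y w z" "z = 0 \<or> z = 1" "0 \<le> w" "0 \<le> \<eta>" "0 \<le> dot n y (mv n B y)"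
  shows "- \<eta> * (1 + dot n y (mv n B y)) \<le>
    (1 - 2 * z) * (w - dot n (mv n B y) (mv n B y)) + w * dot n y (mv n B y)"
proof -
  define b where "b = dot n y (mv n B y)"
  define d where "d = dot n (mv n B y) (mv n B y)"
  have d: "0 \<le> d" unfolding d_def by (rule dot_self_nonneg)
  have b: "0 \<le> b" using assms by (simp add: b_def)
  have "- \<eta> * (1 + b) \<le> (1 - 2 * z) * (w - d) + w * b"
    using assms(2)
  proof
    assume z: "z = 0"
    have "d / (1 + b) - w \<le> \<eta>"
      using assms(1) z b by (simp add: improvable_def toggle_gain_def flip: b_def d_def)
    then have "d \<le> (\<eta> + w) * (1 + b)" using b by (simp add: field_simps)
    then show ?thesis using z by (simp add: algebra_simps)
  next
    assume z: "z = 1"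
    show ?thesis
    proof (cases "b < 1")
      case True
      then have "w - d / (1 - b) \<le> \<eta>"
        using assms(1) z by (simp add: improvable_def toggle_gain_def flip: b_def d_def)
      then have "w * (1 - b) - d \<le> \<eta> * (1 - b)" using True by (simp add: field_simps)
      also have "\<dots> \<le> \<eta> * (1 + b)" using b \<open>0 \<le> \<eta>\<close> by (intro mult_left_mono) auto
      finally show ?thesis using z by (simp add: algebra_simps)
    next
      case False
      then have "w * 1 \<le> w * b" using \<open>0 \<le> w\<close> by (intro mult_left_mono) auto
      moreover have "0 \<le> \<eta> * (1 + b)" using b \<open>0 \<le> \<eta>\<close> by simp
      ultimately show ?thesis using z d by (simp add: algebra_simps)
    qed
  qed
  then show ?thesis by (simp add: b_def d_def)
qed

text \<open>The local optimality conditions are averaged with weight \<open>1 - (1 - 2\<epsilon>) x i\<close> on chosen and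
  \<open>(1 - 2\<epsilon>) x i\<close> on discarded indices. As \<open>not_improvable_toggle\<close> has cleared the denominators
  of \<open>toggle_gain\<close>, the spectral terms sum to exact traces without second-order errors.\<close>
lemma local_optimum_cost:
  fixes x z w :: "nat \<Rightarrow> real"
  assumes inv: "psd_inverse n (shifted_gram m (1 - 4 * \<epsilon>) V z) B"
    and gram: "\<And>j k. j < n \<Longrightarrow> k < n \<Longrightarrow> (\<Sum>i<m. x i * (V i j * V i k)) = delta j k"
    and x: "\<And>i. i < m \<Longrightarrow> 0 \<le> x i \<and> x i \<le> 1"
    and z: "\<And>i. i < m \<Longrightarrow> z i = 0 \<or> z i = 1"
    and w: "\<And>i. i < m \<Longrightarrow> 0 \<le> w i \<and> w i \<le> 1"
    and opt: "\<And>i. i < m \<Longrightarrow> \<not> improvable n (1 / real m) B (V i) (w i) (z i)"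
    and eps: "0 < \<epsilon>" "\<epsilon> \<le> 1 / 2" and "0 < n" "0 < m"
    and budget: "15 * real n / \<epsilon>\<^sup>2 \<le> (\<Sum>i<m. w i * x i)"
  shows "(\<Sum>i<m. w i * z i) \<le> (\<Sum>i<m. w i * x i)"
proof -
  define b where "b i = dot n (V i) (mv n B (V i))" for i
  define d where "d i = dot n (mv n B (V i)) (mv n B (V i))" for i
  \<comment> \<open>The value lies halfway between \<open>1 - 4 * \<epsilon>\<close> and
    \<open>1\<close>: scaling \<open>x\<close> by \<open>g\<close> leaves a margin of
    \<open>2 * \<epsilon>\<close> both over the spectral shift and in the cost.\<close>
  define g where "g = 1 - 2 * \<epsilon>"
  define \<eta> where "\<eta> = 1 / real m"
  define \<Phi> where "\<Phi> = tr n B"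
  \<comment> \<open>As \<open>B\<close> is symmetric, this is the trace of
    \<open>B\<^sup>2\<close>.\<close>
  define \<Psi> where "\<Psi> = (\<Sum>j<n. \<Sum>k<n. (B j k)\<^sup>2)"
  have g: "0 \<le> g" "g \<le> 1" using eps by (auto simp: g_def)
  have eta: "0 \<le> \<eta>" "\<eta> \<le> 1" "\<eta> * real m = 1" using \<open>0 < m\<close> by (auto simp: \<eta>_def)
  have b: "0 \<le> b i" for i unfolding b_def by (rule psd_inverse_nonneg[OF inv])
  have xb: "(\<Sum>i<m. x i * b i) = \<Phi>"
    unfolding b_def \<Phi>_def tr_def
    by (subst sum_dot_mv_gram[where G = delta]) (simp_all add: gram sum_mult_delta)
  have xd: "(\<Sum>i<m. x i * d i) = \<Psi>"
    unfolding d_def \<Psi>_def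
    by (subst sum_dot_mv_mv_gram[where G = delta])
      (simp_all add: gram sum_mult_delta power2_eq_square)
  define A where "A = shifted_gram m (1 - 4 * \<epsilon>) V z"
  \<comment> \<open>The Gram matrix of the selection is \<open>A\<close> plus a multiple of the
    identity. Against \<open>B\<close> the part \<open>A\<close> collapses: it contributes
    \<open>n\<close> to \<open>zb\<close> and the trace of \<open>B\<close> to
    \<open>zd\<close>.\<close>
  have Gz: "(\<Sum>i<m. z i * (V i j * V i k)) = A j k + (1 - 4 * \<epsilon>) * delta j k" for j k
    by (simp add: A_def shifted_gram_def)
  have inv': "psd_inverse n A B" using inv by (simp add: A_def)
  have zb: "(\<Sum>i<m. z i * b i) = real n + (1 - 4 * \<epsilon>) * \<Phi>"
  proof -
    have "(\<Sum>i<m. z i * b i) = (\<Sum>k<n. (\<Sum>l<n. B k l * A k l) + (1 - 4 * \<epsilon>) * B k k)"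
      unfolding b_def sum_dot_mv_gram[where G = "\<lambda>j k. A j k + (1 - 4 * \<epsilon>) * delta j k", OF Gz]
      by (intro sum.cong refl)
        (simp add: distrib_left sum.distrib sum_mult_delta mult.left_commute[of "B _ _"]
          flip: sum_distrib_left)
    also have "\<dots> = (\<Sum>k<n. 1 + (1 - 4 * \<epsilon>) * B k k)"
    proof (intro sum.cong refl)
      fix k assume "k \<in> {..<n}"
      then have k: "k < n" by simp
      have "(\<Sum>l<n. B k l * A k l) = (\<Sum>l<n. B k l * A l k)"
        using k psd_inverse_sym(1)[OF inv'] by (intro sum.cong) auto
      also have "\<dots> = 1" using psd_inverse_mult[OF inv' k k] by (simp add: delta_def)
      finally show "(\<Sum>l<n. B k l * A k l) + (1 - 4 * \<epsilon>) * B k k = 1 + (1 - 4 * \<epsilon>) * B k k"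
        by simp
    qed
    also have "\<dots> = real n + (1 - 4 * \<epsilon>) * \<Phi>"
      by (simp add: \<Phi>_def tr_def sum.distrib sum_distrib_left)
    finally show ?thesis .
  qed
  have zd: "(\<Sum>i<m. z i * d i) = \<Phi> + (1 - 4 * \<epsilon>) * \<Psi>"
  proof -
    have "(\<Sum>i<m. z i * d i) =
        (\<Sum>j<n. \<Sum>k<n. B j k * (\<Sum>l<n. B j l * A l k) + (1 - 4 * \<epsilon>) * (B j k)\<^sup>2)"
      unfolding d_def sum_dot_mv_mv_gram[where G = "\<lambda>j k. A j k + (1 - 4 * \<epsilon>) * delta j k", OF Gz]
    proof (intro sum.cong refl)
      fix j k assume "j \<in> {..<n}" "k \<in> {..<n}"
      then have k: "k < n" by simp
      have "(\<Sum>l<n. B j k * B j l * (A k l + (1 - 4 * \<epsilon>) * delta k l)) =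
          (\<Sum>l<n. B j k * (B j l * A l k) + (if l = k then (1 - 4 * \<epsilon>) * (B j k)\<^sup>2 else 0))"
        using k psd_inverse_sym(1)[OF inv']
        by (intro sum.cong) (auto simp: delta_def algebra_simps power2_eq_square)
      then show "(\<Sum>l<n. B j k * B j l * (A k l + (1 - 4 * \<epsilon>) * delta k l)) =
          B j k * (\<Sum>l<n. B j l * A l k) + (1 - 4 * \<epsilon>) * (B j k)\<^sup>2"
        using k by (simp add: sum.distrib sum_distrib_left)
    qed
    also have "\<dots> = (\<Sum>j<n. \<Sum>k<n. B j k * delta j k + (1 - 4 * \<epsilon>) * (B j k)\<^sup>2)"
      by (intro sum.cong refl) (simp add: psd_inverse_mult[OF inv'])
    also have "\<dots> = \<Phi> + (1 - 4 * \<epsilon>) * \<Psi>"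
      by (simp add: \<Phi>_def \<Psi>_def tr_def sum.distrib sum_distrib_left sum_mult_delta)
    finally show ?thesis .
  qed
  have summand: "- \<eta> * (1 + (x i + z i) * b i) \<le> (g * x i - z i) * (w i - d i) + (x i + z i) * b i"
    if i: "i < m" for i
  proof -
    \<comment> \<open>Both cases satisfy \<open>p * (1 - 2 * z i) = g * x i - z i\<close>, so the
      sum over \<open>i\<close> compares the scaled fractional totals with the chosen ones;
      \<open>p \<le> x i + z i\<close> controls the error terms.\<close>
    define p where "p = (if z i = 1 then 1 - g * x i else g * x i)"
    have gx: "0 \<le> g * x i" "g * x i \<le> x i" "x i \<le> 1"
      using g x[OF i] by (auto intro: mult_left_le_one_le)
    have p: "0 \<le> p" "p \<le> 1" "p \<le> x i + z i" "p * (1 - 2 * z i) = g * x i - z i"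
      using gx z[OF i] by (auto simp: p_def)
    have pb: "p * b i \<le> (x i + z i) * b i" using p b by (intro mult_right_mono) auto
    have "- \<eta> * (1 + (x i + z i) * b i) \<le> - \<eta> * (p + p * b i)"
      using eta p pb by (intro mult_left_mono_neg) auto
    also have "\<dots> = p * (- \<eta> * (1 + b i))" by (simp add: algebra_simps)
    also have "\<dots> \<le> p * ((1 - 2 * z i) * (w i - d i) + w i * b i)"
      using not_improvable_toggle[OF opt[OF i] z[OF i]] w[OF i] b[of i] p(1)
      by (intro mult_left_mono) (auto simp: \<eta>_def b_def d_def)
    also have "\<dots> = (g * x i - z i) * (w i - d i) + w i * (p * b i)"
      by (simp add: algebra_simps flip: p(4))
    also have "w i * (p * b i) \<le> 1 * (p * b i)"
      using w[OF i] p b by (intro mult_right_mono) auto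
    finally show ?thesis using pb by simp
  qed
  have "(\<Sum>i<m. - \<eta> * (1 + (x i + z i) * b i)) \<le>
      (\<Sum>i<m. (g * x i - z i) * (w i - d i) + (x i + z i) * b i)"
    by (intro sum_mono summand) simp
  moreover have "(\<Sum>i<m. - \<eta> * (1 + (x i + z i) * b i)) =
      - (\<eta> * real m) - \<eta> * ((\<Sum>i<m. x i * b i) + (\<Sum>i<m. z i * b i))"
    by (simp add: algebra_simps sum.distrib sum_subtractf sum_negf sum_distrib_left)
  moreover have "(\<Sum>i<m. (g * x i - z i) * (w i - d i) + (x i + z i) * b i) =
      g * (\<Sum>i<m. w i * x i) - (\<Sum>i<m. w i * z i) - g * (\<Sum>i<m. x i * d i) + (\<Sum>i<m. z i * d i)
      + ((\<Sum>i<m. x i * b i) + (\<Sum>i<m. z i * b i))"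
    by (simp add: algebra_simps sum.distrib sum_subtractf sum_distrib_left)
  ultimately have "- (\<eta> * real m) - \<eta> * ((\<Sum>i<m. x i * b i) + (\<Sum>i<m. z i * b i)) \<le>
      g * (\<Sum>i<m. w i * x i) - (\<Sum>i<m. w i * z i) - g * (\<Sum>i<m. x i * d i) + (\<Sum>i<m. z i * d i)
      + ((\<Sum>i<m. x i * b i) + (\<Sum>i<m. z i * b i))"
    by (simp only:)
  then have main: "(\<Sum>i<m. w i * z i) \<le> g * (\<Sum>i<m. w i * x i) - g * \<Psi>
      + \<Phi> + (1 - 4 * \<epsilon>) * \<Psi> + (1 + \<eta>) * (\<Phi> + real n + (1 - 4 * \<epsilon>) * \<Phi>) + 1"
    unfolding xb xd zb zd eta(3) by (simp add: algebra_simps)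
  have Phi: "0 \<le> \<Phi>" unfolding \<Phi>_def by (rule tr_nonneg[OF inv])
  have "\<Phi> + real n + (1 - 4 * \<epsilon>) * \<Phi> \<le> real n + 2 * \<Phi>" using Phi eps by (simp add: algebra_simps)
  \<comment> \<open>For \<open>\<epsilon> > 1 / 4\<close> the coefficient
    \<open>1 - 4 * \<epsilon>\<close> is negative but at least \<open>-1\<close>, so the first
    \<open>\<Phi>\<close> compensates it.\<close>
  moreover have "0 \<le> \<Phi> + real n + (1 - 4 * \<epsilon>) * \<Phi>"
    using Phi eps mult_right_mono[of "4 * \<epsilon>" 2 \<Phi>] by (simp add: algebra_simps)
  ultimately have "(1 + \<eta>) * (\<Phi> + real n + (1 - 4 * \<epsilon>) * \<Phi>) \<le> 2 * (real n + 2 * \<Phi>)"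
    using eta by (intro mult_mono) auto
  with main have main2: "(\<Sum>i<m. w i * z i) \<le>
      g * (\<Sum>i<m. w i * x i) + (5 * \<Phi> - 2 * \<epsilon> * \<Psi>) + 2 * real n + 1"
    by (simp add: g_def algebra_simps)
  \<comment> \<open>Dropping the off-diagonal squares from \<open>\<Psi>\<close> leaves one scalar
    quadratic per diagonal entry.\<close>
  have "5 * \<Phi> - 2 * \<epsilon> * \<Psi> \<le> (\<Sum>j<n. 5 * B j j - 2 * \<epsilon> * (B j j)\<^sup>2)"
  proof -
    have "(\<Sum>j<n. (B j j)\<^sup>2) \<le> \<Psi>"
      unfolding \<Psi>_def by (intro sum_mono member_le_sum) auto
    then have "2 * \<epsilon> * (\<Sum>j<n. (B j j)\<^sup>2) \<le> 2 * \<epsilon> * \<Psi>" using eps by simp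
    then show ?thesis by (simp add: \<Phi>_def tr_def sum_subtractf sum_distrib_left)
  qed
  also have "\<dots> \<le> (\<Sum>j<n. 4 / \<epsilon>)"
  proof (intro sum_mono)
    fix j
    \<comment> \<open>Completing the square: \<open>5 * u - 2 * u\<^sup>2\<close> with
      \<open>u = \<epsilon> * B j j\<close> peaks at \<open>25 / 8\<close>, and \<open>7 / 8\<close>
      is the distance to \<open>4\<close>.\<close>
    have "0 \<le> 2 * (\<epsilon> * B j j - 5 / 4)\<^sup>2 + 7 / 8" by simp
    then have "\<epsilon> * (5 * B j j - 2 * \<epsilon> * (B j j)\<^sup>2) \<le> 4"
      by (simp add: power2_eq_square algebra_simps)
    then show "5 * B j j - 2 * \<epsilon> * (B j j)\<^sup>2 \<le> 4 / \<epsilon>" using eps by (simp add: field_simps)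
  qed
  also have "\<dots> = 4 * (real n / \<epsilon>)" by simp
  finally have "5 * \<Phi> - 2 * \<epsilon> * \<Psi> \<le> 4 * (real n / \<epsilon>)" .
  moreover have "2 * real n + 1 \<le> 3 * real n" using \<open>0 < n\<close> by simp
  moreover have "real n \<le> real n / \<epsilon>"
    using eps mult_right_mono[of \<epsilon> 1 "real n"] by (simp add: field_simps)
  \<comment> \<open>The margin in the cost is worth \<open>30 * (n / \<epsilon>)\<close>, while the
    accumulated errors are at most \<open>7 * (n / \<epsilon>)\<close>.\<close>
  moreover have "30 * (real n / \<epsilon>) \<le> 2 * \<epsilon> * (\<Sum>i<m. w i * x i)"
    using mult_left_mono[OF budget, of "2 * \<epsilon>"] eps by (simp add: power2_eq_square)
  moreover have "0 \<le> real n / \<epsilon>" using eps by simp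
  moreover have "g * (\<Sum>i<m. w i * x i) = (\<Sum>i<m. w i * x i) - 2 * \<epsilon> * (\<Sum>i<m. w i * x i)"
    by (simp add: g_def algebra_simps)
  ultimately show ?thesis using main2 by linarith
qed

section \<open>The rounding program\<close>

abbreviation scalar :: "vname \<Rightarrow> rexp" where
  "scalar A \<equiv> RCell A (IConst 0) (IConst 0)"

abbreviation entry :: "vname \<Rightarrow> vname \<Rightarrow> rexp" where
  "entry A i \<equiv> RCell A (IVar i) (IConst 0)"

abbreviation set_scalar :: "vname \<Rightarrow> rexp \<Rightarrow> com" where
  "set_scalar A \<equiv> RAssign A (IConst 0) (IConst 0)"

abbreviation set_entry :: "vname \<Rightarrow> vname \<Rightarrow> rexp \<Rightarrow> com" where
  "set_entry A i \<equiv> RAssign A (IVar i) (IConst 0)"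

text \<open>The Sherman--Morrison denominator, shared by the test and the update.\<close>

abbreviation quotient_term :: rexp where
  "quotient_term \<equiv> RAdd (RConst 1) (RMul (scalar ''s'') (scalar ''p''))"

text \<open>With \<open>y\<close> the vector of index \<open>''i''\<close>, \<open>direction\<close> stores \<open>B y\<close> in \<open>''u''\<close>, \<open>\<langle>y, B y\<rangle>\<close> in \<open>''p''\<close>
  and \<open>\<langle>B y, B y\<rangle>\<close> in \<open>''q''\<close>.\<close>

definition direction_row :: com where
  "direction_row = For ''k'' (IVar ''n'') (set_entry ''u'' ''j'' (RAdd (entry ''u'' ''j'')
     (RMul (RCell ''B'' (IVar ''j'') (IVar ''k'')) (RCell ''v'' (IVar ''i'') (IVar ''k'')))))"

definition direction :: com where
  "direction =
     set_scalar ''p'' (RConst 0) ;; set_scalar ''q'' (RConst 0) ;;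
     For ''j'' (IVar ''n'') (
       set_entry ''u'' ''j'' (RConst 0) ;;
       direction_row ;;
       set_scalar ''p'' (RAdd (scalar ''p'')
         (RMul (RCell ''v'' (IVar ''i'') (IVar ''j'')) (entry ''u'' ''j''))) ;;
       set_scalar ''q'' (RAdd (scalar ''q'') (RMul (entry ''u'' ''j'') (entry ''u'' ''j''))))"

text \<open>Overwriting \<open>''B''\<close> in place is safe because \<open>''u''\<close> and
  \<open>''p''\<close> were computed beforehand.\<close>

definition update_row :: com where
  "update_row = For ''k'' (IVar ''n'') (RAssign ''B'' (IVar ''j'') (IVar ''k'')
     (RSub (RCell ''B'' (IVar ''j'') (IVar ''k''))
       (RMul (RDiv (scalar ''s'') quotient_term) (RMul (entry ''u'' ''j'') (entry ''u'' ''k'')))))"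

definition update :: com where
  "update = For ''j'' (IVar ''n'') update_row"

definition toggle :: com where
  "toggle =
     direction ;;
     set_scalar ''s'' (RSub (RConst 1) (RMul (RConst 2) (entry ''z'' ''i''))) ;;
     Cond (TAnd (RLess (RConst 0) quotient_term)
         (RLess (RDiv (RConst 1) (scalar ''count''))
           (RSub (RDiv (RMul (scalar ''s'') (scalar ''q'')) quotient_term)
             (RMul (scalar ''s'') (RDiv (entry ''c'' ''i'') (scalar ''max''))))))
       (update ;; set_entry ''z'' ''i'' (RAdd (entry ''z'' ''i'') (scalar ''s'')))
       Skip"

text \<open>Cells outside the input arrays start at \<open>0\<close>, so neither \<open>''count''\<close>, \<open>''max''\<close> nor the
  off-diagonal entries of \<open>''B''\<close> are initialised.\<close>

definition measure_costs :: com where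
  "measure_costs = For ''i'' (IVar ''m'') (
     set_scalar ''count'' (RAdd (scalar ''count'') (RConst 1)) ;;
     Cond (RLess (scalar ''max'') (entry ''c'' ''i'')) (set_scalar ''max'' (entry ''c'' ''i'')) Skip)"

definition scalar_matrix :: com where
  "scalar_matrix = For ''j'' (IVar ''n'')
     (RAssign ''B'' (IVar ''j'') (IVar ''j'') (RDiv (RConst 1) (RMul (RConst 4) (scalar ''eps''))))"

text \<open>The inverse for the full set is reached from that for the weights \<open>x\<close> by
  rank-one updates, each raising one weight to \<open>1\<close>; no general matrix inversion is
  programmed.\<close>

definition select_all :: com where
  "select_all = For ''i'' (IVar ''m'') (
     direction ;;
     set_scalar ''s'' (RSub (RConst 1) (entry ''x'' ''i'')) ;;
     update ;;
     set_entry ''z'' ''i'' (RConst 1))"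

text \<open>Index expressions have no multiplication, so the \<open>(2 * m + 1) * m\<close> sweeps
  are spread over two nested loops. Sweeps after an optimum is reached change nothing.\<close>

definition local_search :: com where
  "local_search = For ''a'' (IAdd (IAdd (IVar ''m'') (IVar ''m'')) (IConst 1))
     (For ''b'' (IVar ''m'') (For ''i'' (IVar ''m'') toggle))"

definition rounding_program :: com where
  "rounding_program = measure_costs ;; scalar_matrix ;; select_all ;; local_search"

section \<open>Contracts of the subroutines\<close>

definition frame :: "vname set \<Rightarrow> vname set \<Rightarrow> state \<Rightarrow> state \<Rightarrow> bool" where
  "frame R X s t \<longleftrightarrow> (\<forall>r. r \<notin> R \<longrightarrow> ireg t r = ireg s r) \<and> (\<forall>A. A \<notin> X \<longrightarrow> cell t A = cell s A)"

lemma ireg_set [simp]: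
  "ireg (set_ireg i k s) = (ireg s)(i := k)" "ireg (set_cell A a b r s) = ireg s"
  by (simp_all add: set_ireg_def set_cell_def)

lemma cell_set [simp]:
  "cell (set_ireg i k s) = cell s"
  "cell (set_cell A a b r s) = (cell s)(A := (cell s A)(a := (cell s A a)(b := r)))"
  by (simp_all add: set_ireg_def set_cell_def)

lemma wp_direction_row:
  assumes "ireg s ''n'' = n" "n \<le> N"
  shows "wp direction_row (N * 5 + 3) (\<lambda>t. frame {''k''} {''u''} s t \<and>
    cell t ''u'' = (cell s ''u'')(ireg s ''j'' := (cell s ''u'' (ireg s ''j''))(0 :=
      cell s ''u'' (ireg s ''j'') 0 + mv n (cell s ''B'') (cell s ''v'' (ireg s ''i'')) (ireg s ''j'')))) s"
proof -
  let ?P = "\<lambda>k t. frame {''k''} {''u''} s t \<and> ireg t ''k'' = k \<and>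
    cell t ''u'' = (cell s ''u'')(ireg s ''j'' := (cell s ''u'' (ireg s ''j''))(0 :=
      cell s ''u'' (ireg s ''j'') 0 + mv k (cell s ''B'') (cell s ''v'' (ireg s ''i'')) (ireg s ''j'')))"
  have "wp direction_row (N * (1 + 4) + 3) (\<lambda>t. ?P n t) s"
    unfolding direction_row_def
  proof (rule wp_For[where P = ?P and N = n])
    show "wp (set_entry ''u'' ''j'' (RAdd (entry ''u'' ''j'') (RMul (RCell ''B'' (IVar ''j'') (IVar ''k''))
        (RCell ''v'' (IVar ''i'') (IVar ''k''))))) 1 (\<lambda>t'. ?P (Suc k) (set_ireg ''k'' (Suc (ireg t' ''k'')) t')) t"
      if "?P k t" for k t
      using that by (intro wp_RAssign) (auto simp: frame_def mv_def fun_eq_iff)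
  qed (use assms in \<open>auto simp: frame_def mv_def\<close>)
  then show ?thesis by (rule wp_conseq) auto
qed

lemma wp_direction:
  assumes "ireg s ''n'' = n" "n \<le> N"
    and y: "y = cell s ''v'' (ireg s ''i'')"
  shows "wp direction (N * (N * 5 + 13) + 7) (\<lambda>t. frame {''j'', ''k''} {''u'', ''p'', ''q''} s t \<and>
    (\<forall>j<n. cell t ''u'' j 0 = mv n (cell s ''B'') y j) \<and>
    cell t ''p'' 0 0 = dot n y (mv n (cell s ''B'') y) \<and>
    cell t ''q'' 0 0 = dot n (mv n (cell s ''B'') y) (mv n (cell s ''B'') y)) s"
proof -
  let ?u = "mv n (cell s ''B'') y"
  let ?P = "\<lambda>j t. frame {''j'', ''k''} {''u'', ''p'', ''q''} s t \<and> ireg t ''j'' = j \<and>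
    (\<forall>l<j. cell t ''u'' l 0 = ?u l) \<and> cell t ''p'' 0 0 = dot j y ?u \<and> cell t ''q'' 0 0 = dot j ?u ?u"
  have "wp direction (1 + (1 + (N * ((1 + ((N * 5 + 3) + (1 + 1 + 1) + 1) + 1) + 4) + 3) + 1) + 1) (?P n) s"
    unfolding direction_def
  proof (intro wp_Seq wp_RAssign, rule wp_For[where P = ?P and N = n])
    fix j t
    assume P: "?P j t" and "j < n"
    let ?t = "set_cell ''u'' (ival (IVar ''j'') t) (ival (IConst 0) t) (rval (RConst 0) t) t"
    have row: "mv n (cell ?t ''B'') (cell ?t ''v'' (ireg ?t ''i'')) (ireg ?t ''j'') = ?u j"
      using P by (simp add: frame_def y)
    show "wp (set_entry ''u'' ''j'' (RConst 0) ;; direction_row ;;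
       set_scalar ''p'' (RAdd (scalar ''p'')
         (RMul (RCell ''v'' (IVar ''i'') (IVar ''j'')) (entry ''u'' ''j''))) ;;
       set_scalar ''q'' (RAdd (scalar ''q'') (RMul (entry ''u'' ''j'') (entry ''u'' ''j''))))
       (1 + ((N * 5 + 3) + (1 + 1 + 1) + 1) + 1)
       (\<lambda>t'. ?P (Suc j) (set_ireg ''j'' (Suc (ireg t' ''j'')) t')) t"
    proof (intro wp_Seq wp_RAssign, rule wp_conseq[OF wp_direction_row[of _ n N]])
      show "ireg ?t ''n'' = n" using P assms by (simp add: frame_def)
    next
      fix t'
      assume "frame {''k''} {''u''} ?t t' \<and> cell t' ''u'' = (cell ?t ''u'')(ireg ?t ''j'' :=
        (cell ?t ''u'' (ireg ?t ''j''))(0 := cell ?t ''u'' (ireg ?t ''j'') 0 +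
          mv n (cell ?t ''B'') (cell ?t ''v'' (ireg ?t ''i'')) (ireg ?t ''j'')))"
      then show "wp (set_scalar ''p'' (RAdd (scalar ''p'')
         (RMul (RCell ''v'' (IVar ''i'') (IVar ''j'')) (entry ''u'' ''j''))) ;;
         set_scalar ''q'' (RAdd (scalar ''q'') (RMul (entry ''u'' ''j'') (entry ''u'' ''j''))))
         (1 + 1 + 1) (\<lambda>t'. ?P (Suc j) (set_ireg ''j'' (Suc (ireg t' ''j'')) t')) t'"
        using P unfolding row
        by (intro wp_Seq wp_RAssign) (auto simp: frame_def y dot_def less_Suc_eq)
    qed (use assms in auto)
  qed (use assms in \<open>auto simp: frame_def dot_def\<close>)
  then show ?thesis by (rule wp_conseq) (auto simp: algebra_simps)
qed

text \<open>The contract covers every entry, with untouched ones losing \<open>0\<close>, so that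
  the rows can be chained in the outer loop.\<close>

lemma wp_update_row:
  assumes "ireg s ''n'' = n" "n \<le> N"
  shows "wp update_row (N * 5 + 3) (\<lambda>t. frame {''k''} {''B''} s t \<and>
    (\<forall>a b. cell t ''B'' a b = cell s ''B'' a b - (if a = ireg s ''j'' \<and> b < n then
      cell s ''s'' 0 0 / (1 + cell s ''s'' 0 0 * cell s ''p'' 0 0) * (cell s ''u'' a 0 * cell s ''u'' b 0)
      else 0))) s"
proof -
  let ?P = "\<lambda>k t. frame {''k''} {''B''} s t \<and> ireg t ''k'' = k \<and>
    (\<forall>a b. cell t ''B'' a b = cell s ''B'' a b - (if a = ireg s ''j'' \<and> b < k then
      cell s ''s'' 0 0 / (1 + cell s ''s'' 0 0 * cell s ''p'' 0 0) * (cell s ''u'' a 0 * cell s ''u'' b 0)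
      else 0))"
  have "wp update_row (N * (1 + 4) + 3) (?P n) s"
    unfolding update_row_def
  proof (rule wp_For[where P = ?P and N = n], goal_cases)
    case (3 k t)
    then show ?case by (intro wp_RAssign) (auto simp: frame_def less_Suc_eq)
  qed (use assms in \<open>auto simp: frame_def\<close>)
  then show ?thesis by (rule wp_conseq) auto
qed

lemma wp_update:
  assumes "ireg s ''n'' = n" "n \<le> N"
  shows "wp update (N * (N * 5 + 7) + 3) (\<lambda>t. frame {''j'', ''k''} {''B''} s t \<and>
    (\<forall>j<n. \<forall>k<n. cell t ''B'' j k = cell s ''B'' j k -
      cell s ''s'' 0 0 / (1 + cell s ''s'' 0 0 * cell s ''p'' 0 0) * (cell s ''u'' j 0 * cell s ''u'' k 0))) s"
proof -
  let ?P = "\<lambda>j t. frame {''j'', ''k''} {''B''} s t \<and> ireg t ''j'' = j \<and>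
    (\<forall>a b. cell t ''B'' a b = cell s ''B'' a b - (if a < j \<and> b < n then
      cell s ''s'' 0 0 / (1 + cell s ''s'' 0 0 * cell s ''p'' 0 0) * (cell s ''u'' a 0 * cell s ''u'' b 0)
      else 0))"
  have "wp update (N * ((N * 5 + 3) + 4) + 3) (?P n) s"
    unfolding update_def
  proof (rule wp_For[where P = ?P and N = n], goal_cases)
    case (3 j t)
    show ?case
      by (rule wp_conseq[OF wp_update_row[of _ n N]])
        (use 3 assms in \<open>auto simp: frame_def less_Suc_eq\<close>)
  qed (use assms in \<open>auto simp: frame_def\<close>)
  then show ?thesis
  proof (rule wp_conseq)
    show "N * ((N * 5 + 3) + 4) + 3 \<le> N * (N * 5 + 7) + 3" by (simp add: algebra_simps)
  qed auto
qed

lemma wp_measure_costs: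
  assumes "ireg s ''m'' = m" "m \<le> N" "cell s ''count'' 0 0 = 0" "cell s ''max'' 0 0 = 0"
  shows "wp measure_costs (N * 8 + 3) (\<lambda>t. frame {''i''} {''count'', ''max''} s t \<and>
    cell t ''count'' 0 0 = real m \<and>
    cell t ''max'' 0 0 = Max (insert 0 ((\<lambda>i. cell s ''c'' i 0) ` {..<m}))) s"
proof -
  \<comment> \<open>Inserting \<open>0\<close> accounts for the initial content of
    \<open>''max''\<close> and gives the empty prefix a maximum.\<close>
  define M where "M i = Max (insert 0 ((\<lambda>i. cell s ''c'' i 0) ` {..<i}))" for i
  have M_0: "M 0 = 0" by (simp add: M_def)
  have M_Suc: "M (Suc i) = max (cell s ''c'' i 0) (M i)" for i
    unfolding M_def
    by (simp add: lessThan_Suc insert_commute[of 0] del: Max_insert) (subst Max_insert, auto)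
  let ?P = "\<lambda>i t. frame {''i''} {''count'', ''max''} s t \<and> ireg t ''i'' = i \<and>
    cell t ''count'' 0 0 = real i \<and> cell t ''max'' 0 0 = M i"
  have "wp measure_costs (N * ((1 + (1 + 1) + 1) + 4) + 3) (?P m) s"
    unfolding measure_costs_def
  proof (rule wp_For[where P = ?P and N = m], goal_cases)
    case (3 i t)
    then show ?case
      by (intro wp_Seq wp_RAssign wp_Cond wp_Skip) (auto simp: frame_def M_Suc)
  qed (use assms in \<open>auto simp: frame_def M_0\<close>)
  then show ?thesis by (rule wp_conseq) (auto simp: M_def)
qed

lemma wp_scalar_matrix:
  assumes "ireg s ''n'' = n" "n \<le> N"
  shows "wp scalar_matrix (N * 5 + 3) (\<lambda>t. frame {''j''} {''B''} s t \<and>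
    (\<forall>a b. cell t ''B'' a b =
      (if a = b \<and> a < n then 1 / (4 * cell s ''eps'' 0 0) else cell s ''B'' a b))) s"
proof -
  let ?P = "\<lambda>j t. frame {''j''} {''B''} s t \<and> ireg t ''j'' = j \<and>
    (\<forall>a b. cell t ''B'' a b = (if a = b \<and> a < j then 1 / (4 * cell s ''eps'' 0 0) else cell s ''B'' a b))"
  have "wp scalar_matrix (N * (1 + 4) + 3) (?P n) s"
    unfolding scalar_matrix_def
  proof (rule wp_For[where P = ?P and N = n], goal_cases)
    case (3 j t)
    then show ?case by (intro wp_RAssign) (auto simp: frame_def less_Suc_eq)
  qed (use assms in \<open>auto simp: frame_def\<close>)
  then show ?thesis by (rule wp_conseq) auto
qed

section \<open>Correctness of the program\<close>

locale rounding_input =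
  fixes n m :: nat and v :: "nat \<Rightarrow> real vec" and x c :: "real vec" and \<epsilon> :: real
  assumes v: "\<And>i. i < m \<Longrightarrow> v i \<in> carrier_vec n"
    and x: "x \<in> carrier_vec m" "\<And>i. i < m \<Longrightarrow> 0 \<le> x $ i \<and> x $ i \<le> 1"
    and c: "c \<in> carrier_vec m" "\<And>i. i < m \<Longrightarrow> 0 \<le> c $ i"
    and eps: "0 < \<epsilon>" "\<epsilon> \<le> 1 / 2"
    and gram: "weighted_gram n m x v = 1\<^sub>m n"
    and budget: "c \<bullet> x \<ge> 15 * real n * max_entry c / \<epsilon>\<^sup>2"
begin

abbreviation input :: state where
  "input \<equiv> input_state n m v x c \<epsilon>"

text \<open>Read off the input cells, so that it equals the array of a later state as a function,
  beyond the index range too.\<close>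

definition V :: "nat \<Rightarrow> nat \<Rightarrow> real" where
  "V = cell input ''v''"

text \<open>The inserted \<open>0\<close> matches the program; for \<open>m > 0\<close> the value is
  \<open>max_entry c\<close>, as costs are nonnegative.\<close>

definition cmax :: real where
  "cmax = Max (insert 0 ((\<lambda>i. cell input ''c'' i 0) ` {..<m}))"

text \<open>If all costs vanish then so do the weights, as \<open>r / 0 = 0\<close>.\<close>
definition weight :: "nat \<Rightarrow> real" where
  "weight i = cell input ''c'' i 0 / cmax"

abbreviation shifted :: "(nat \<Rightarrow> real) \<Rightarrow> nat \<Rightarrow> nat \<Rightarrow> real" where
  "shifted \<equiv> shifted_gram m (1 - 4 * \<epsilon>) V"

definition selection :: "state \<Rightarrow> nat \<Rightarrow> real" where
  "selection t i = cell t ''z'' i 0"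

definition prepared :: "state \<Rightarrow> bool" where
  "prepared t \<longleftrightarrow> ireg t ''n'' = n \<and> ireg t ''m'' = m \<and>
     cell t ''v'' = cell input ''v'' \<and> cell t ''x'' = cell input ''x'' \<and> cell t ''c'' = cell input ''c'' \<and>
     cell t ''count'' 0 0 = real m \<and> cell t ''max'' 0 0 = cmax"

definition feasible :: "state \<Rightarrow> bool" where
  "feasible t \<longleftrightarrow> prepared t \<and> (\<forall>i<m. selection t i = 0 \<or> selection t i = 1) \<and>
     psd_inverse n (shifted (selection t)) (cell t ''B'')"

definition potential :: "state \<Rightarrow> real" where
  "potential t = tr n (cell t ''B'') + (\<Sum>i<m. weight i * selection t i)"

definition improvable_at :: "state \<Rightarrow> nat \<Rightarrow> bool" where
  "improvable_at t i \<longleftrightarrow> improvable n (1 / real m) (cell t ''B'') (V i) (weight i) (selection t i)"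

definition locally_optimal :: "state \<Rightarrow> bool" where
  "locally_optimal t \<longleftrightarrow> (\<forall>i<m. \<not> improvable_at t i)"

section \<open>Elementary facts about the input\<close>

lemma V: "i < m \<Longrightarrow> j < n \<Longrightarrow> V i j = v i $ j"
  by (simp add: V_def input_state_def)

lemma input_vectors: "i < m \<Longrightarrow> cell input ''x'' i 0 = x $ i" "i < m \<Longrightarrow> cell input ''c'' i 0 = c $ i"
  by (simp_all add: input_state_def)

lemma gram_V: "j < n \<Longrightarrow> k < n \<Longrightarrow> (\<Sum>i<m. x $ i * (V i j * V i k)) = delta j k"
proof -
  assume jk: "j < n" "k < n"
  then have "(\<Sum>i<m. x $ i * (V i j * V i k)) = weighted_gram n m x v $$ (j, k)"
    by (simp add: weighted_gram_def V)
  then show ?thesis using jk by (simp add: gram delta_def)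
qed

lemma cmax_nonneg: "0 \<le> cmax"
  unfolding cmax_def by (rule Max_ge) auto

lemma weight: "i < m \<Longrightarrow> 0 \<le> weight i \<and> weight i \<le> 1"
proof -
  assume i: "i < m"
  then have "c $ i \<le> cmax"
    unfolding cmax_def by (intro Max_ge) (auto simp: input_vectors)
  then show ?thesis using i c(2)[OF i] cmax_nonneg
    by (auto simp: weight_def input_vectors divide_simps)
qed

text \<open>The step \<open>\<sigma>\<close> is general because the same code raises a fractional
  weight by \<open>1 - x $ i\<close> and toggles an index by \<open>1\<close> or
  \<open>-1\<close>.\<close>

lemma wp_update_psd:
  assumes s: "prepared s" "psd_inverse n (shifted y) (cell s ''B'')" "i < m" "n \<le> N"
    and p: "cell s ''p'' 0 0 = dot n (V i) (mv n (cell s ''B'') (V i))"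
    and u: "\<And>j. j < n \<Longrightarrow> cell s ''u'' j 0 = mv n (cell s ''B'') (V i) j"
    and \<sigma>: "cell s ''s'' 0 0 = \<sigma>" "0 < 1 + \<sigma> * dot n (V i) (mv n (cell s ''B'') (V i))"
  shows "wp update (N * (N * 5 + 7) + 3) (\<lambda>t. frame {''j'', ''k''} {''B''} s t \<and>
    psd_inverse n (shifted (y(i := y i + \<sigma>))) (cell t ''B'') \<and>
    tr n (cell t ''B'') = tr n (cell s ''B'') -
      \<sigma> / (1 + \<sigma> * dot n (V i) (mv n (cell s ''B'') (V i))) *
      dot n (mv n (cell s ''B'') (V i)) (mv n (cell s ''B'') (V i))) s"
proof (rule wp_conseq[OF wp_update[of _ n N]])
  let ?u = "mv n (cell s ''B'') (V i)"
  fix t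
  assume t: "frame {''j'', ''k''} {''B''} s t \<and> (\<forall>j<n. \<forall>k<n. cell t ''B'' j k = cell s ''B'' j k -
    cell s ''s'' 0 0 / (1 + cell s ''s'' 0 0 * cell s ''p'' 0 0) * (cell s ''u'' j 0 * cell s ''u'' k 0))"
  then have B: "cell t ''B'' j k = cell s ''B'' j k - \<sigma> / (1 + \<sigma> * dot n (V i) ?u) * (?u j * ?u k)"
    if "j < n" "k < n" for j k using that by (simp add: p u \<sigma>(1))
  have "psd_inverse n (shifted (y(i := y i + \<sigma>))) (cell t ''B'')"
    by (rule psd_inverse_cong[OF psd_inverse_rank_one[OF s(2) \<sigma>(2)]])
      (simp_all add: shifted_gram_upd \<open>i < m\<close> B)
  moreover have "tr n (cell t ''B'') =
      tr n (\<lambda>j k. cell s ''B'' j k - \<sigma> / (1 + \<sigma> * dot n (V i) ?u) * (?u j * ?u k))"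
    by (simp add: tr_def B)
  ultimately show "frame {''j'', ''k''} {''B''} s t \<and>
    psd_inverse n (shifted (y(i := y i + \<sigma>))) (cell t ''B'') \<and>
    tr n (cell t ''B'') = tr n (cell s ''B'') -
      \<sigma> / (1 + \<sigma> * dot n (V i) ?u) * dot n ?u ?u"
    using t by (simp only: tr_rank_one)
qed (use s in \<open>auto simp: prepared_def\<close>)

lemma wp_toggle:
  assumes s: "feasible s" "i < m" "ireg s ''i'' = i" and "n \<le> N"
  shows "wp toggle (N * (N * 10 + 20) + 16) (\<lambda>t. feasible t \<and>
    (\<forall>r. r \<noteq> ''j'' \<and> r \<noteq> ''k'' \<longrightarrow> ireg t r = ireg s r) \<and>
    (if improvable_at s i then potential t \<le> potential s - 1 / real m
     else cell t ''B'' = cell s ''B'' \<and> cell t ''z'' = cell s ''z'')) s"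
    (is "wp _ _ ?Q s")
proof -
  let ?B = "cell s ''B''"
  let ?u = "mv n ?B (V i)"
  define \<sigma> where "\<sigma> = 1 - 2 * selection s i"
  have prep: "prepared s" and sel: "\<And>i. i < m \<Longrightarrow> selection s i = 0 \<or> selection s i = 1"
    and inv: "psd_inverse n (shifted (selection s)) ?B"
    using s by (auto simp: feasible_def)
  have "wp toggle ((N * (N * 5 + 13) + 7) + (1 + ((N * (N * 5 + 7) + 3) + 1 + 1 + 1) + 1) + 1) ?Q s"
    unfolding toggle_def
  proof (rule wp_Seq, rule wp_conseq[OF wp_direction[of _ n N "V i"]])
    fix t
    assume t: "frame {''j'', ''k''} {''u'', ''p'', ''q''} s t \<and>
      (\<forall>j<n. cell t ''u'' j 0 = ?u j) \<and> cell t ''p'' 0 0 = dot n (V i) ?u \<and> cell t ''q'' 0 0 = dot n ?u ?u"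
    let ?e = "RSub (RConst 1) (RMul (RConst 2) (entry ''z'' ''i''))"
    let ?t = "set_cell ''s'' (ival (IConst 0) t) (ival (IConst 0) t) (rval ?e t) t"
    let ?test = "TAnd (RLess (RConst 0) quotient_term)
         (RLess (RDiv (RConst 1) (scalar ''count''))
           (RSub (RDiv (RMul (scalar ''s'') (scalar ''q'')) quotient_term)
             (RMul (scalar ''s'') (RDiv (entry ''c'' ''i'') (scalar ''max'')))))"
    \<comment> \<open>\<open>prepared\<close> identifies \<open>''count''\<close> and
      \<open>''max''\<close> with \<open>m\<close> and \<open>cmax\<close>, so the machine evaluates
      the condition of \<open>improvable_at\<close> term by term.\<close>
    have test: "tval ?test ?t \<longleftrightarrow> improvable_at s i"
      using t prep s(3)
      by (simp add: frame_def prepared_def improvable_at_def improvable_def toggle_gain_def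
          selection_def weight_def)
    have \<sigma>: "cell ?t ''s'' 0 0 = \<sigma>" using t s(3) by (simp add: frame_def \<sigma>_def selection_def)
    have B: "cell ?t ''B'' = ?B" using t by (simp add: frame_def)
    have prep': "prepared ?t" using t prep by (simp add: frame_def prepared_def)
    show "wp (set_scalar ''s'' ?e ;; Cond ?test
        (update ;; set_entry ''z'' ''i'' (RAdd (entry ''z'' ''i'') (scalar ''s''))) Skip)
        (1 + ((N * (N * 5 + 7) + 3) + 1 + 1 + 1) + 1) ?Q t"
    proof (intro wp_Seq wp_RAssign wp_Cond wp_Skip)
      assume "\<not> tval ?test ?t"
      then have "\<not> improvable_at s i" using test by blast
      then show "?Q ?t"
        using t prep' sel inv unfolding feasible_def B
        by (auto simp: frame_def selection_def[abs_def])
    next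
      assume "tval ?test ?t"
      then have imp: "improvable_at s i" using test by blast
      then have pos: "0 < 1 + \<sigma> * dot n (V i) ?u"
        and gain: "1 / real m < \<sigma> * dot n ?u ?u / (1 + \<sigma> * dot n (V i) ?u) - \<sigma> * weight i"
        by (simp_all add: improvable_at_def improvable_def toggle_gain_def \<sigma>_def)
      show "wp update (N * (N * 5 + 7) + 3) (wp (set_entry ''z'' ''i'' (RAdd (entry ''z'' ''i'') (scalar ''s''))) 1 ?Q) ?t"
      proof (rule wp_conseq[OF wp_update_psd[where y = "selection s" and i = i and N = N and \<sigma> = \<sigma>]])
        fix t'
        assume t': "frame {''j'', ''k''} {''B''} ?t t' \<and>
          psd_inverse n (shifted ((selection s)(i := selection s i + \<sigma>))) (cell t' ''B'') \<and>
          tr n (cell t' ''B'') = tr n (cell ?t ''B'') -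
            \<sigma> / (1 + \<sigma> * dot n (V i) (mv n (cell ?t ''B'') (V i))) *
            dot n (mv n (cell ?t ''B'') (V i)) (mv n (cell ?t ''B'') (V i))"
        let ?t' = "set_cell ''z'' (ival (IVar ''i'') t') (ival (IConst 0) t')
          (rval (RAdd (entry ''z'' ''i'') (scalar ''s'')) t') t'"
        have i': "ireg t' ''i'' = i" using t t' s(3) by (simp add: frame_def)
        have z: "selection ?t' = (selection s)(i := selection s i + \<sigma>)"
          using t t' i' \<sigma> by (auto simp: fun_eq_iff selection_def frame_def)
        have zi: "selection s i + \<sigma> = 0 \<or> selection s i + \<sigma> = 1"
          using sel[OF s(2)] by (auto simp: \<sigma>_def)
        have "feasible ?t'"
          unfolding feasible_def z
          using t' prep' sel zi by (auto simp: frame_def prepared_def)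
        moreover have "potential ?t' \<le> potential s - 1 / real m"
        proof -
          have "(\<Sum>l<m. weight l * ((selection s)(i := selection s i + \<sigma>)) l) =
              (\<Sum>l<m. weight l * selection s l + (if l = i then weight i * \<sigma> else 0))"
            by (intro sum.cong) (auto simp: algebra_simps)
          then have "(\<Sum>l<m. weight l * ((selection s)(i := selection s i + \<sigma>)) l) =
              (\<Sum>l<m. weight l * selection s l) + weight i * \<sigma>"
            using s(2) by (simp add: sum.distrib)
          moreover have "tr n (cell ?t' ''B'') =
              tr n ?B - \<sigma> / (1 + \<sigma> * dot n (V i) ?u) * dot n ?u ?u"
            using t' unfolding B by simp
          ultimately show ?thesis using gain unfolding potential_def z
            by (simp add: algebra_simps)
        qed
        moreover have "\<forall>r. r \<noteq> ''j'' \<and> r \<noteq> ''k'' \<longrightarrow> ireg ?t' r = ireg s r"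
          using t t' by (simp add: frame_def)
        ultimately have "?Q ?t'" using imp by simp
        then show "wp (set_entry ''z'' ''i'' (RAdd (entry ''z'' ''i'') (scalar ''s''))) 1 ?Q t'"
          by (rule wp_RAssign)
      next
        show "psd_inverse n (shifted (selection s)) (cell ?t ''B'')" unfolding B by (rule inv)
        show "cell ?t ''p'' 0 0 = dot n (V i) (mv n (cell ?t ''B'') (V i))" unfolding B using t by simp
        show "cell ?t ''u'' j 0 = mv n (cell ?t ''B'') (V i) j" if "j < n" for j
          unfolding B using t that by simp
        show "0 < 1 + \<sigma> * dot n (V i) (mv n (cell ?t ''B'') (V i))" unfolding B by (rule pos)
      qed (fact prep' \<sigma> s(2) \<open>n \<le> N\<close> order_refl)+
    qed
  qed (use prep s \<open>n \<le> N\<close> in \<open>auto simp: prepared_def V_def\<close>)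
  then show ?thesis by (rule wp_time) (auto simp: algebra_simps)
qed

text \<open>Raising a weight adds a positive semidefinite matrix: the denominators stay positive and
  the trace of the inverse can only fall. The cost part is at most \<open>m\<close>, as every weight
  is at most \<open>1\<close>.\<close>

lemma wp_select_all:
  assumes s: "prepared s" "psd_inverse n (shifted (\<lambda>i. x $ i)) (cell s ''B'')"
    and N: "n \<le> N" "m \<le> N"
  shows "wp select_all (N * (N * (N * 10 + 20) + 19) + 3) (\<lambda>t. feasible t \<and>
    potential t \<le> tr n (cell s ''B'') + real m) s"
proof -
  \<comment> \<open>Hybrid weights: indices before \<open>i\<close> are already selected, the others
    still fractional.\<close>
  let ?y = "\<lambda>i l. if l < i then 1 else x $ l"
  let ?P = "\<lambda>i t. prepared t \<and> ireg t ''i'' = i \<and> (\<forall>l<i. selection t l = 1) \<and>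
    psd_inverse n (shifted (?y i)) (cell t ''B'') \<and> tr n (cell t ''B'') \<le> tr n (cell s ''B'')"
  have "wp select_all (N * (((N * (N * 5 + 13) + 7) + (1 + ((N * (N * 5 + 7) + 3) + 1 + 1) + 1) + 1) + 4) + 3)
    (?P m) s"
    unfolding select_all_def
  proof (rule wp_For[where P = ?P and N = m])
    fix i s'
    assume s': "?P i s'" and i: "i < m"
    let ?B = "cell s' ''B''"
    let ?u = "mv n ?B (V i)"
    let ?e = "RSub (RConst 1) (entry ''x'' ''i'')"
    let ?Q = "\<lambda>t'. ?P (Suc i) (set_ireg ''i'' (Suc (ireg t' ''i'')) t')"
    show "wp (direction ;; set_scalar ''s'' ?e ;; update ;; set_entry ''z'' ''i'' (RConst 1))
      ((N * (N * 5 + 13) + 7) + (1 + ((N * (N * 5 + 7) + 3) + 1 + 1) + 1) + 1) ?Q s'"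
    proof (rule wp_Seq, rule wp_conseq[OF wp_direction[of _ n N "V i"]])
      fix t
      assume t: "frame {''j'', ''k''} {''u'', ''p'', ''q''} s' t \<and>
        (\<forall>j<n. cell t ''u'' j 0 = ?u j) \<and> cell t ''p'' 0 0 = dot n (V i) ?u \<and> cell t ''q'' 0 0 = dot n ?u ?u"
      let ?t = "set_cell ''s'' (ival (IConst 0) t) (ival (IConst 0) t) (rval ?e t) t"
      have \<sigma>: "cell ?t ''s'' 0 0 = 1 - x $ i"
        using t s' i by (simp add: frame_def prepared_def input_vectors)
      have B: "cell ?t ''B'' = ?B" using t by (simp add: frame_def)
      have prep: "prepared ?t" using t s' by (simp add: frame_def prepared_def)
      have inv: "psd_inverse n (shifted (?y i)) ?B" using s' by blast
      have pos: "0 < 1 + (1 - x $ i) * dot n (V i) ?u"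
        using x(2)[OF i] psd_inverse_nonneg[OF inv, of "V i"] by (intro add_pos_nonneg) auto
      show "wp (set_scalar ''s'' ?e ;; update ;; set_entry ''z'' ''i'' (RConst 1))
        (1 + ((N * (N * 5 + 7) + 3) + 1 + 1) + 1) ?Q t"
      proof (intro wp_Seq wp_RAssign,
          rule wp_conseq[OF wp_update_psd[where y = "?y i" and i = i and N = N and \<sigma> = "1 - x $ i"]])
        fix t'
        assume t': "frame {''j'', ''k''} {''B''} ?t t' \<and>
          psd_inverse n (shifted ((?y i)(i := ?y i i + (1 - x $ i)))) (cell t' ''B'') \<and>
          tr n (cell t' ''B'') = tr n (cell ?t ''B'') -
            (1 - x $ i) / (1 + (1 - x $ i) * dot n (V i) (mv n (cell ?t ''B'') (V i))) *
            dot n (mv n (cell ?t ''B'') (V i)) (mv n (cell ?t ''B'') (V i))"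
        have y: "(?y i)(i := ?y i i + (1 - x $ i)) = ?y (Suc i)" by (auto simp: fun_eq_iff)
        have "0 \<le> (1 - x $ i) / (1 + (1 - x $ i) * dot n (V i) ?u) * dot n ?u ?u"
          using x(2)[OF i] pos by (intro mult_nonneg_nonneg divide_nonneg_nonneg dot_self_nonneg) auto
        then have "tr n (cell t' ''B'') \<le> tr n ?B" using t' unfolding B by linarith
        moreover have "psd_inverse n (shifted (?y (Suc i))) (cell t' ''B'')" using t' y by simp
        ultimately show "wp (set_entry ''z'' ''i'' (RConst 1)) 1 ?Q t'"
          using s' t t' prep
          by (intro wp_RAssign) (auto simp: frame_def prepared_def selection_def less_Suc_eq)
      next
        show "psd_inverse n (shifted (?y i)) (cell ?t ''B'')" unfolding B by (rule inv)
        show "cell ?t ''p'' 0 0 = dot n (V i) (mv n (cell ?t ''B'') (V i))" unfolding B using t by simp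
        show "cell ?t ''u'' j 0 = mv n (cell ?t ''B'') (V i) j" if "j < n" for j
          unfolding B using t that by simp
        show "0 < 1 + (1 - x $ i) * dot n (V i) (mv n (cell ?t ''B'') (V i))" unfolding B by (rule pos)
      qed (fact prep \<sigma> i N(1) order_refl)+
    qed (use s' N in \<open>auto simp: prepared_def V_def\<close>)
  qed (use s N in \<open>auto simp: prepared_def\<close>)
  then show ?thesis
  proof (rule wp_conseq)
    fix t assume t: "?P m t"
    have "shifted (?y m) = shifted (selection t)"
      using t by (auto simp: fun_eq_iff shifted_gram_def intro!: sum.cong)
    moreover have "(\<Sum>i<m. weight i * selection t i) \<le> (\<Sum>i<m. 1)"
      using t weight by (intro sum_mono) auto
    ultimately show "feasible t \<and> potential t \<le> tr n (cell s ''B'') + real m"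
      using t by (auto simp: feasible_def potential_def)
  qed (auto simp: algebra_simps)
qed

section \<open>Convergence of the local search\<close>

lemma locally_optimal_cong:
  "cell t ''B'' = cell s ''B'' \<Longrightarrow> cell t ''z'' = cell s ''z'' \<Longrightarrow> locally_optimal t \<longleftrightarrow> locally_optimal s"
  by (simp add: locally_optimal_def improvable_at_def selection_def)

lemma potential_cong:
  "cell t ''B'' = cell s ''B'' \<Longrightarrow> cell t ''z'' = cell s ''z'' \<Longrightarrow> potential t = potential s"
  by (simp add: potential_def selection_def)

text \<open>A sweep without any toggle has tested all indices against the same state, which is
  therefore locally optimal. Otherwise its first toggle lowers the potential by at least
  \<open>1 / m\<close>, and nothing later raises it again.\<close>

lemma wp_sweep:
  assumes s: "feasible s" and N: "n \<le> N" "m \<le> N"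
  shows "wp (For ''i'' (IVar ''m'') toggle) (N * (N * (N * 10 + 20) + 20) + 3) (\<lambda>t. feasible t \<and>
    (\<forall>r. r \<noteq> ''i'' \<and> r \<noteq> ''j'' \<and> r \<noteq> ''k'' \<longrightarrow> ireg t r = ireg s r) \<and>
    (locally_optimal s \<longrightarrow> locally_optimal t) \<and>
    (locally_optimal t \<or> potential t \<le> potential s - 1 / real m)) s"
proof -
  let ?same = "\<lambda>t. cell t ''B'' = cell s ''B'' \<and> cell t ''z'' = cell s ''z''"
  let ?P = "\<lambda>i t. feasible t \<and> ireg t ''i'' = i \<and>
    (\<forall>r. r \<noteq> ''i'' \<and> r \<noteq> ''j'' \<and> r \<noteq> ''k'' \<longrightarrow> ireg t r = ireg s r) \<and>
    (locally_optimal s \<longrightarrow> ?same t) \<and>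
    (?same t \<and> (\<forall>l<i. \<not> improvable_at s l) \<or> potential t \<le> potential s - 1 / real m)"
  have "wp (For ''i'' (IVar ''m'') toggle) (N * ((N * (N * 10 + 20) + 16) + 4) + 3) (?P m) s"
  proof (rule wp_For[where P = ?P and N = m])
    fix i t
    assume t: "?P i t" and i: "i < m"
    have imp: "improvable_at t i \<longleftrightarrow> improvable_at s i" if "?same t"
      using that by (simp add: improvable_at_def selection_def)
    show "wp toggle (N * (N * 10 + 20) + 16) (\<lambda>t'. ?P (Suc i) (set_ireg ''i'' (Suc (ireg t' ''i'')) t')) t"
    proof (rule wp_conseq[OF wp_toggle[of t i N]])
      fix t'
      let ?t' = "set_ireg ''i'' (Suc (ireg t' ''i'')) t'"
      assume t': "feasible t' \<and> (\<forall>r. r \<noteq> ''j'' \<and> r \<noteq> ''k'' \<longrightarrow> ireg t' r = ireg t r) \<and>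
        (if improvable_at t i then potential t' \<le> potential t - 1 / real m
         else cell t' ''B'' = cell t ''B'' \<and> cell t' ''z'' = cell t ''z'')"
      have "feasible ?t'" using t' by (simp add: feasible_def prepared_def selection_def[abs_def])
      moreover have pot: "potential ?t' = potential t'" by (rule potential_cong) simp_all
      moreover have "locally_optimal s \<longrightarrow> ?same ?t'"
        using t t' imp i by (auto simp: locally_optimal_def)
      moreover have "?same ?t' \<and> (\<forall>l<Suc i. \<not> improvable_at s l) \<or> potential ?t' \<le> potential s - 1 / real m"
      proof (cases "improvable_at t i")
        case True
        then have le: "potential t' \<le> potential t - 1 / real m" using t' by simp
        have "potential t \<le> potential s"
        proof (cases "?same t")
          case False
          then have "potential t \<le> potential s - 1 / real m" using t by blast
          also have "\<dots> \<le> potential s" by simp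
          finally show ?thesis .
        next
          case True
          then have "potential t = potential s" by (intro potential_cong) auto
          then show ?thesis by simp
        qed
        then show ?thesis using le pot by simp
      next
        case False
        then have same: "cell t' ''B'' = cell t ''B''" "cell t' ''z'' = cell t ''z''" using t' by auto
        then show ?thesis using t False imp pot potential_cong[OF same] by (auto simp: less_Suc_eq)
      qed
      ultimately show "?P (Suc i) ?t'" using t t' by auto
    qed (use t i N in auto)
  qed (use s N in \<open>auto simp: feasible_def prepared_def selection_def[abs_def]\<close>)
  then show ?thesis
  proof (rule wp_conseq)
    fix t assume t: "?P m t"
    then show "feasible t \<and>
      (\<forall>r. r \<noteq> ''i'' \<and> r \<noteq> ''j'' \<and> r \<noteq> ''k'' \<longrightarrow> ireg t r = ireg s r) \<and>
      (locally_optimal s \<longrightarrow> locally_optimal t) \<and>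
      (locally_optimal t \<or> potential t \<le> potential s - 1 / real m)"
      using locally_optimal_cong[of t s] by (auto simp: locally_optimal_def[of s])
  qed auto
qed

text \<open>Until an optimum is reached, \<open>m\<close> sweeps lower the potential by
  \<open>1\<close>, hence \<open>2 * m + 1\<close> rounds of them by \<open>2 * m + 1\<close>; an
  optimum persists.\<close>

lemma wp_local_search:
  assumes s: "feasible s" and N: "n \<le> N" "m \<le> N"
  shows "wp local_search ((N + N + 1) * ((N * ((N * (N * (N * 10 + 20) + 20) + 3) + 4) + 3) + 4) + 3)
    (\<lambda>t. feasible t \<and> (locally_optimal t \<or> potential t \<le> potential s - (2 * real m + 1))) s"
proof -
  let ?P = "\<lambda>a t. feasible t \<and> ireg t ''a'' = a \<and>
    (locally_optimal t \<or> potential t \<le> potential s - real a)"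
  let ?R = "\<lambda>a b t. feasible t \<and> ireg t ''a'' = a \<and> ireg t ''b'' = b \<and>
    (locally_optimal t \<or> potential t \<le> potential s - real a - real b / real m)"
  have cong: "potential (set_ireg r k t) = potential t"
    "locally_optimal (set_ireg r k t) = locally_optimal t" for r k t
    by (intro potential_cong locally_optimal_cong; simp)+
  have feas: "feasible (set_ireg r k t) = feasible t" if "r \<noteq> ''n''" "r \<noteq> ''m''" for r k t
    using that by (simp add: feasible_def prepared_def selection_def[abs_def])
  have regs: "ireg t ''n'' = n" "ireg t ''m'' = m" if "feasible t" for t
    using that by (simp_all add: feasible_def prepared_def)
  have "wp local_search ((N + N + 1) * ((N * ((N * (N * (N * 10 + 20) + 20) + 3) + 4) + 3) + 4) + 3)
    (?P (m + m + 1)) s"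
    unfolding local_search_def
  proof (rule wp_For[where P = ?P and N = "m + m + 1"])
    fix a t
    assume t: "?P a t"
    show "wp (For ''b'' (IVar ''m'') (For ''i'' (IVar ''m'') toggle))
      (N * ((N * (N * (N * 10 + 20) + 20) + 3) + 4) + 3)
      (\<lambda>t'. ?P (Suc a) (set_ireg ''a'' (Suc (ireg t' ''a'')) t')) t"
    proof (rule wp_For[where P = "?R a" and N = m])
      fix b t
      assume t: "?R a b t"
      show "wp (For ''i'' (IVar ''m'') toggle) (N * (N * (N * 10 + 20) + 20) + 3)
        (\<lambda>t'. ?R a (Suc b) (set_ireg ''b'' (Suc (ireg t' ''b'')) t')) t"
      proof (rule wp_conseq[OF wp_sweep[of t N]])
        fix t'
        assume t': "feasible t' \<and>
          (\<forall>r. r \<noteq> ''i'' \<and> r \<noteq> ''j'' \<and> r \<noteq> ''k'' \<longrightarrow> ireg t' r = ireg t r) \<and>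
          (locally_optimal t \<longrightarrow> locally_optimal t') \<and>
          (locally_optimal t' \<or> potential t' \<le> potential t - 1 / real m)"
        have "real (Suc b) / real m = real b / real m + 1 / real m" by (simp add: add_divide_distrib)
        then have "locally_optimal t' \<or> potential t' \<le> potential s - real a - real (Suc b) / real m"
          using t t' by linarith
        moreover have "ireg t' ''a'' = ireg t ''a''" "ireg t' ''b'' = ireg t ''b''" using t' by auto
        ultimately show "?R a (Suc b) (set_ireg ''b'' (Suc (ireg t' ''b'')) t')"
          using t t' by (simp only: cong) (simp add: feas)
      qed (use t N in auto)
    next
      show "?P (Suc a) (set_ireg ''a'' (Suc (ireg t' ''a'')) t')" if "?R a m t'" for t'
      proof -
        have "locally_optimal t' \<or> potential t' \<le> potential s - real (Suc a)"
        proof (cases "m = 0")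
          \<comment> \<open>Here \<open>real b / real m\<close> is \<open>0\<close> by convention
            and records no progress, but local optimality is vacuous.\<close>
          case True
          then have "locally_optimal t'" unfolding locally_optimal_def by simp
          then show ?thesis ..
        next
          case False
          then show ?thesis using that by auto
        qed
        then show ?thesis using that by (simp only: cong) (simp add: feas)
      qed
    qed (use t N in \<open>auto simp: cong feas regs\<close>)
  qed (use s N in \<open>auto simp: cong feas regs\<close>)
  then show ?thesis by (rule wp_conseq) auto
qed

text \<open>Unless all costs vanish, the budget forces \<open>n / (4 * \<epsilon>) \<le> m\<close>,
  so the second alternative would make the potential negative. What remains is a local optimum, and
  scaling by \<open>cmax\<close> returns to the original costs.\<close>

lemma cost_bound:
  assumes t: "feasible t" "locally_optimal t \<or> potential t \<le> real n / (4 * \<epsilon>) - (real m + 1)"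
    and "0 < n"
  shows "(\<Sum>i<m. c $ i * selection t i) \<le> (\<Sum>i<m. c $ i * x $ i)"
proof (cases "cmax = 0")
  case True
  have "c $ i = 0" if i: "i < m" for i
  proof -
    have "c $ i \<le> cmax" unfolding cmax_def using i by (intro Max_ge) (auto simp: input_vectors)
    then show ?thesis using True c(2)[OF i] by simp
  qed
  then show ?thesis by simp
next
  case False
  then have pos: "0 < cmax" using cmax_nonneg by simp
  \<comment> \<open>For \<open>n > 0\<close> a diagonal entry of the identity cannot be an empty
    sum.\<close>
  have m: "0 < m"
  proof (rule ccontr)
    assume "\<not> 0 < m"
    then show False using gram_V[of 0 0] \<open>0 < n\<close> by (simp add: delta_def)
  qed
  have scale: "(\<Sum>i<m. c $ i * y i) = cmax * (\<Sum>i<m. weight i * y i)" for y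
    unfolding sum_distrib_left using pos
    by (intro sum.cong) (auto simp: weight_def input_vectors)
  have "cmax = max_entry c"
  proof -
    have "{c $ i |i. i < dim_vec c} = (\<lambda>i. cell input ''c'' i 0) ` {..<m}"
      using c(1) by (auto simp: input_vectors image_iff)
    moreover have "0 \<le> Max ((\<lambda>i. cell input ''c'' i 0) ` {..<m})"
    proof (rule order_trans)
      show "0 \<le> cell input ''c'' 0 0" using m c(2) by (simp add: input_vectors)
      show "cell input ''c'' 0 0 \<le> Max ((\<lambda>i. cell input ''c'' i 0) ` {..<m})"
        using m by (intro Max_ge) auto
    qed
    ultimately show ?thesis using m
      by (simp add: cmax_def max_entry_def lessThan_empty_iff)
  qed
  then have "15 * real n * cmax / \<epsilon>\<^sup>2 \<le> cmax * (\<Sum>i<m. weight i * x $ i)"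
    using budget c(1) x(1) scale[of "\<lambda>i. x $ i"]
    by (simp add: scalar_prod_def atLeast0LessThan)
  then have "cmax * (15 * real n / \<epsilon>\<^sup>2) \<le> cmax * (\<Sum>i<m. weight i * x $ i)" by (simp add: mult_ac)
  then have budget': "15 * real n / \<epsilon>\<^sup>2 \<le> (\<Sum>i<m. weight i * x $ i)"
    by (rule mult_left_le_imp_le) (rule pos)
  have "locally_optimal t"
  proof -
    have "real n / (4 * \<epsilon>) = \<epsilon> / 4 * (real n / \<epsilon>\<^sup>2)" using eps by (simp add: power2_eq_square)
    also have "\<dots> \<le> 15 * (real n / \<epsilon>\<^sup>2)" using eps by (intro mult_right_mono) auto
    also have "\<dots> \<le> (\<Sum>i<m. weight i * x $ i)" using budget' by simp
    also have "\<dots> \<le> (\<Sum>i<m. 1)" using weight x(2) by (intro sum_mono mult_le_one) auto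
    finally have "real n / (4 * \<epsilon>) \<le> real m" by simp
    moreover have "0 \<le> potential t"
    proof -
      have "0 \<le> tr n (cell t ''B'')" using t(1) by (auto simp: feasible_def intro: tr_nonneg)
      moreover have "0 \<le> (\<Sum>i<m. weight i * selection t i)"
        using t(1) weight by (intro sum_nonneg mult_nonneg_nonneg) (auto simp: feasible_def)
      ultimately show ?thesis by (simp add: potential_def)
    qed
    ultimately show ?thesis using t(2) by linarith
  qed
  have "(\<Sum>i<m. weight i * selection t i) \<le> (\<Sum>i<m. weight i * x $ i)"
  proof (rule local_optimum_cost[where B = "cell t ''B''" and V = V])
    show "psd_inverse n (shifted (selection t)) (cell t ''B'')"
      "\<And>i. i < m \<Longrightarrow> selection t i = 0 \<or> selection t i = 1"
      using t by (auto simp: feasible_def)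
    show "\<not> improvable n (1 / real m) (cell t ''B'') (V i) (weight i) (selection t i)" if "i < m" for i
      using \<open>locally_optimal t\<close> that by (simp add: locally_optimal_def improvable_at_def)
  qed (use gram_V x(2) weight eps \<open>0 < n\<close> m budget' in auto)
  then show ?thesis using pos by (simp add: scale)
qed

text \<open>The invariant already contains this semidefiniteness; it only has to be carried over to
  the matrix type of the statement.\<close>

lemma feasible_loewner:
  assumes t: "feasible t"
  shows "weighted_gram n m (output_vec m t) v \<succeq> (1 - 4 * \<epsilon>) \<cdot>\<^sub>m 1\<^sub>m n"
proof -
  let ?D = "weighted_gram n m (output_vec m t) v - (1 - 4 * \<epsilon>) \<cdot>\<^sub>m 1\<^sub>m n"
  have D: "?D \<in> carrier_mat n n" by (intro minus_carrier_mat smult_carrier_mat one_carrier_mat)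
  have entry: "?D $$ (j, k) = shifted (selection t) j k" if "j < n" "k < n" for j k
    using that by (simp add: weighted_gram_def shifted_gram_def output_vec_def selection_def delta_def V)
  have inv: "psd_inverse n (shifted (selection t)) (cell t ''B'')"
    using t by (simp add: feasible_def)
  have "?D\<^sup>T = ?D"
    using psd_inverse_sym(1)[OF inv] D
    by (intro eq_matI) (auto simp: entry simp del: index_minus_mat index_smult_mat)
  moreover have "0 \<le> w \<bullet> (?D *\<^sub>v w)" if w: "w \<in> carrier_vec n" for w
  proof -
    have "w \<bullet> (?D *\<^sub>v w) = dot n (($) w) (mv n (shifted (selection t)) (($) w))"
      using D w
      by (simp add: scalar_prod_def dot_def mv_def atLeast0LessThan entry
          del: index_minus_mat index_smult_mat)
    then show ?thesis using inv by (simp add: psd_inverse_def)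
  qed
  ultimately show ?thesis using D unfolding loewner_ge_def psd_def by auto
qed

text \<open>The potential enters the search at no more than \<open>n / (4 * \<epsilon>) + m\<close>,
  and without an optimum it would fall by \<open>2 * m + 1\<close>. The step count keeps the shape
  in which the rules compose.\<close>

lemma wp_rounding_program:
  fixes N defines "N \<equiv> n + m"
  shows "wp rounding_program
    ((N * 8 + 3) + ((N * 5 + 3) + ((N * (N * (N * 10 + 20) + 19) + 3) +
      ((N + N + 1) * ((N * ((N * (N * (N * 10 + 20) + 20) + 3) + 4) + 3) + 4) + 3) + 1) + 1) + 1)
    (\<lambda>t. feasible t \<and> (locally_optimal t \<or> potential t \<le> real n / (4 * \<epsilon>) - (real m + 1))) input"
  unfolding rounding_program_def
proof (rule wp_Seq, rule wp_conseq[OF wp_measure_costs[of _ m N]])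
  have N: "n \<le> N" "m \<le> N" by (simp_all add: N_def)
  show "ireg input ''m'' = m" "m \<le> N" "cell input ''count'' 0 0 = 0" "cell input ''max'' 0 0 = 0"
    by (simp_all add: input_state_def N)
  fix s
  assume s: "frame {''i''} {''count'', ''max''} input s \<and> cell s ''count'' 0 0 = real m \<and>
    cell s ''max'' 0 0 = Max (insert 0 ((\<lambda>i. cell input ''c'' i 0) ` {..<m}))"
  then have ps: "prepared s"
    by (simp add: frame_def prepared_def cmax_def) (simp add: input_state_def)
  have "cell s ''eps'' 0 0 = \<epsilon>" "cell s ''B'' = (\<lambda>a b. 0)"
    using s by (simp_all add: frame_def input_state_def)
  note sB = this
  show "wp (scalar_matrix ;; select_all ;; local_search)
    ((N * 5 + 3) + ((N * (N * (N * 10 + 20) + 19) + 3) +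
      ((N + N + 1) * ((N * ((N * (N * (N * 10 + 20) + 20) + 3) + 4) + 3) + 4) + 3) + 1) + 1)
    (\<lambda>t. feasible t \<and> (locally_optimal t \<or> potential t \<le> real n / (4 * \<epsilon>) - (real m + 1))) s"
  proof (rule wp_Seq, rule wp_conseq[OF wp_scalar_matrix[of _ n N]])
    show "ireg s ''n'' = n" "n \<le> N" using ps N by (simp_all add: prepared_def)
    fix t
    assume t: "frame {''j''} {''B''} s t \<and> (\<forall>a b. cell t ''B'' a b =
      (if a = b \<and> a < n then 1 / (4 * cell s ''eps'' 0 0) else cell s ''B'' a b))"
    have pt: "prepared t" using t ps by (simp add: frame_def prepared_def)
    have inv: "psd_inverse n (shifted (\<lambda>i. x $ i)) (cell t ''B'')"
    proof (rule psd_inverse_cong[OF psd_inverse_scalar[of "4 * \<epsilon>" n]])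
      show "4 * \<epsilon> * delta j k = shifted (\<lambda>i. x $ i) j k" if "j < n" "k < n" for j k
        using gram_V[OF that] by (simp add: shifted_gram_def algebra_simps)
    qed (use t sB eps in \<open>auto simp: delta_def\<close>)
    have tr: "tr n (cell t ''B'') = real n / (4 * \<epsilon>)" using t sB by (simp add: tr_def)
    show "wp (select_all ;; local_search)
      ((N * (N * (N * 10 + 20) + 19) + 3) + ((N + N + 1) * ((N * ((N * (N * (N * 10 + 20) + 20) + 3) + 4) + 3) + 4) + 3) + 1)
      (\<lambda>t. feasible t \<and> (locally_optimal t \<or> potential t \<le> real n / (4 * \<epsilon>) - (real m + 1))) t"
    proof (rule wp_Seq, rule wp_conseq[OF wp_select_all[OF pt inv N]])
      fix u assume u: "feasible u \<and> potential u \<le> tr n (cell t ''B'') + real m"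
      then show "wp local_search
        ((N + N + 1) * ((N * ((N * (N * (N * 10 + 20) + 20) + 3) + 4) + 3) + 4) + 3)
        (\<lambda>t. feasible t \<and> (locally_optimal t \<or> potential t \<le> real n / (4 * \<epsilon>) - (real m + 1))) u"
        by (intro wp_conseq[OF wp_local_search[OF _ N]]) (auto simp: tr)
    qed simp
  qed simp
qed simp

end

theorem theorem4p10:
  shows "\<exists>\<kappa>>0. \<exists>(prog :: com) (q :: nat poly).
    \<forall>(n :: nat) (m :: nat) (v :: nat \<Rightarrow> real vec) (x :: real vec) (c :: real vec) (\<epsilon> :: real).
      (\<forall>i<m. v i \<in> carrier_vec n) \<longrightarrow>
      x \<in> carrier_vec m \<longrightarrow> (\<forall>i<m. 0 \<le> x $ i \<and> x $ i \<le> 1) \<longrightarrow>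
      c \<in> carrier_vec m \<longrightarrow> (\<forall>i<m. 0 \<le> c $ i) \<longrightarrow>
      0 < \<epsilon> \<longrightarrow> \<epsilon> \<le> 1 / 2 \<longrightarrow>
      weighted_gram n m x v = 1\<^sub>m n \<longrightarrow>
      c \<bullet> x \<ge> 15 * real n * max_entry c / \<epsilon>\<^sup>2 \<longrightarrow>
      (let s = input_state n m v x c \<epsilon>; T = poly q (n + m) in
        halts_within T prog s \<and>
        (\<forall>cfg \<in> set_pmf (run T (prog, s)). \<forall>i<m. output_vec m (snd cfg) $ i \<in> {0, 1}) \<and>
        measure_pmf.prob (run T (prog, s))
          {cfg. let z = output_vec m (snd cfg) in
             c \<bullet> z \<le> c \<bullet> x \<and>
             weighted_gram n m z v \<succeq> (1 - 4 * \<epsilon>) \<cdot>\<^sub>m 1\<^sub>m n}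
          \<ge> 1 - exp (- \<kappa> * real n))"
proof -
  define X :: "nat poly" where "X = [:0, 1:]"
  define q :: "nat poly" where "q =
    (X * 8 + 3) + ((X * 5 + 3) + ((X * (X * (X * 10 + 20) + 19) + 3) +
      ((X + X + 1) * ((X * ((X * (X * (X * 10 + 20) + 20) + 3) + 4) + 3) + 4) + 3) + 1) + 1) + 1"
  have q: "poly q N = (N * 8 + 3) + ((N * 5 + 3) + ((N * (N * (N * 10 + 20) + 19) + 3) +
      ((N + N + 1) * ((N * ((N * (N * (N * 10 + 20) + 20) + 3) + 4) + 3) + 4) + 3) + 1) + 1) + 1" for N
    unfolding q_def X_def by simp
  show ?thesis
  \<comment> \<open>For \<open>n > 0\<close> the run is a point mass on a successful output, so
    every positive \<open>\<kappa>\<close> serves and \<open>1\<close> is taken; for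
    \<open>n = 0\<close> the required probability \<open>1 - exp 0\<close> is
    \<open>0\<close>.\<close>
  proof (rule exI[of _ 1], rule conjI, simp, intro exI[of _ rounding_program] exI[of _ q] allI impI, goal_cases)
    case (1 n m v x c \<epsilon>)
    then interpret rounding_input n m v x c \<epsilon> by unfold_locales auto
    obtain t where run: "run (poly q (n + m)) (rounding_program, input) = return_pmf (Skip, t)"
      and t: "feasible t" "locally_optimal t \<or> potential t \<le> real n / (4 * \<epsilon>) - (real m + 1)"
      using wp_rounding_program unfolding wp_def q by blast
    have "c \<bullet> output_vec m t \<le> c \<bullet> x" if "0 < n"
      using cost_bound[OF t that] 1(2,4)
      by (simp add: scalar_prod_def output_vec_def selection_def atLeast0LessThan)
    then have "measure_pmf.prob (return_pmf (Skip, t))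
        {cfg. let z = output_vec m (snd cfg) in
           c \<bullet> z \<le> c \<bullet> x \<and> weighted_gram n m z v \<succeq> (1 - 4 * \<epsilon>) \<cdot>\<^sub>m 1\<^sub>m n} \<ge> 1 - exp (- 1 * real n)"
      using feasible_loewner[OF t(1)] by (cases "n = 0") (simp_all add: Let_def)
    moreover have "\<forall>i<m. output_vec m t $ i \<in> {0, 1}"
      using t(1) by (auto simp: feasible_def selection_def output_vec_def)
    ultimately show ?case unfolding Let_def halts_within_def run by simp
  qed
qed

end
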